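(* Let $\Lambda$ be a topological space, let $d>0$, and let $\mathcal{F}=\{f_\lambda\mid\lambda\in\Lambda\}$ be a family of functions on $[0,d)$ admitting a uniform asymptotic development of order $\ell$, $$f_\lambda(x)=\sum_{i=0}^{\ell}\alpha_i(\lambda)u_i(x,\lambda)+\psi(x,\lambda),$$ in a family of Chebyshev scales $\mathcal{I}_\lambda=(u_0(x,\lambda),u_1(x,\lambda),\ldots,u_\ell(x,\lambda))$. Put $\mathcal{G}=\{g_\lambda=\mathrm{id}-f_\lambda\mid f_\lambda\in\mathcal{F}\}$. Let $\lambda_0\in\Lambda$ and suppose that the functions $u_i=u_i(\cdot,\lambda_0)$, $i\ge1$, of the scale $\mathcal{I}=\mathcal{I}_{\lambda_0}$ are positive and strictly increasing on $(0,d)$. Let $f=f_{\lambda_0}$ be continuous on $[0,d)$, of class $C^r$ on $(0,d)$, positive on $(0,d)$, with $f(0)=f'(0)=0$, and suppose that there exist constants $m>1$ and $M>0$ such that $$m\le x\cdot(\log f)'(x)\le M,\qquad x\in(0,d).$$ Let $g=\mathrm{id}-f$ and let $S^g(x_0)$ be the orbit of a point $x_0\in(0,d)$ in the basin of attraction of $0$. Let $1\le k\le\ell$. Then the following claims are equivalent: (i) $D_i(f)(0)=0$ for $i=0,\ldots,k-1$, and $D_k(f)(0)>0$ (that is, $f\simeq u_k$); (ii) $|A_\varepsilon(S^g(x_0))|\simeq u_k^{-1}(\varepsilon)$ as $\varepsilon\to0$; (iii) $m(g,\mathcal{I})=k$. If moreover $\Lambda\subset\mathbb{R}^N$, $k\le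 N$, and the matrix $\left(\frac{\partial\alpha_i}{\partial\lambda_j}\right)_{i=0,\ldots,k-1,\ j=1,\ldots,k}(\lambda_0)$ is of maximal rank (i.e. of rank $k$), then (i), (ii) or (iii) is also equivalent to (iv) $\mu_0^{fix}(g,\mathcal{G})=k$. Without this regularity assumption, (i), (ii) or (iii) implies $\mu_0^{fix}(g,\mathcal{G})\le k$.
   Context: **Chebyshev scale.** A finite or infinite sequence $\mathcal{I}=\{u_0,u_1,u_2,\ldots\}$ of functions continuous on $[0,d)$ and $C^r$ on $(0,d)$, $r\in\mathbb{N}\cup\{\infty\}$ (with $r$ large enough that the derivatives below exist), is a Chebyshev scale if: (1) the operators $D_i$ given inductively by $D_0(u_k)=\frac{u_k}{u_0}$, $D_{i+1}(u_k)=\frac{(D_i(u_k))'}{(D_i(u_{i+1}))'}$ are well defined for every $k$, except possibly at $x=0$, to which they are extended by continuity; (2) the functions $D_i(u_{i+1})$ are strictly increasing on $[0,d)$; (3) $\lim_{x\to0}D_ju_i(x)=0$ for $j<i$. For a function $f$, $D_i(f)$, defined by the same recursion ($D_0(f)=f/u_0$, $D_{i+1}(f)=(D_i(f))'/(D_i(u_{i+1}))'$), is called the $i$-th generalized derivative of $f$ in the scale $\mathcal{I}$; values at $0$ are understood as limits $x\to0$. **Development.** $f$ has a development of order $\ell$ in $\mathcal{I}=\{u_0,\ldots,u_\ell\}$ if $f=\sum_{i=0}^{\ell}\alpha_iu_i+\psi$ with $\alpha_i\in\mathbb{R}$ and $D_i(\psi)(0)=0$ (limit sense) for $i=0,\ldots,\ell$;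 then $D_i(f)(0)=\alpha_i$. A family $(f_\lambda)$ has a uniform development of order $\ell$ in a family of Chebyshev scales $\mathcal{I}_\lambda$ if each $f_\lambda$ has a development as displayed in the claim and all generalized derivatives $D_jf_\lambda$, $j=0,\ldots,\ell$ (in the scale $\mathcal{I}_\lambda$), extend by continuity to $x=0$ uniformly with respect to $\lambda$, the extension being continuous as a function of $\lambda$. **Comparability, orbits.** $F(x)\simeq G(x)$ as $x\to0$, for positive $F,G$, means there are $A,B,\delta>0$ with $A\le F/G\le B$ on $(0,\delta)$. $S^g(x_0)=\{x_n\mid n\in\mathbb{N}\}$, $x_{n+1}=g(x_n)$, is the orbit of $x_0$ by $g$, lying in $(0,d)$ and tending monotonically to $0$. $|A_\varepsilon(U)|$ is the Lebesgue measure of the $\varepsilon$-neighborhood of $U\subset\mathbb{R}$. $f'(0)$ is the (right) derivative at $0$. **Critical Minkowski order.** For $i=1,\ldots,\ell$ put $$\mathcal{M}_*(S^g(x_0),u_i)=\liminf_{\varepsilon\to0}\frac{|A_\varepsilon(S^g(x_0))|}{u_i^{-1}(\varepsilon)},\qquad \mathcal{M}^*(S^g(x_0),u_i)=\limsup_{\varepsilon\to0}\frac{|A_\varepsilon(S^g(x_0))|}{u_i^{-1}(\varepsilon)},$$ $\underline{m}(g,\mathcal{I})=\max\{i\ge1\mid\mathcal{M}_*(S^g(x_0),u_i)>0\}$ and $\overline{m}(g,\mathcal{I})=\max\{i\ge1\mid\mathcal{M}^*(S^g(x_0),u_i)>0\}$ (independent of $x_0$ in the basin of attraction of $0$). If these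 two coincide, the common value is the critical Minkowski order $m(g,\mathcal{I})$. **Multiplicity in a family.** $x=0$ is a zero of multiplicity $\ge p$ of $f_{\lambda_0}$ in the family $\mathcal{F}=\{f_\lambda\}$ if there is a sequence $\lambda_n\to\lambda_0$ such that, for every $n$, $f_{\lambda_n}$ has $p$ distinct zeros $y_1^n,\ldots,y_p^n\in[0,d)$ different from $x=0$, with $y_j^n\to0$ as $n\to\infty$ for $j=1,\ldots,p$. The multiplicity $\mu_0(f_{\lambda_0},\mathcal{F})$ is the largest integer $p$ for which this holds. The multiplicity of $0$ as a fixed point of $g_{\lambda_0}=\mathrm{id}-f_{\lambda_0}$ in $\mathcal{G}$ is $\mu_0^{fix}(g_{\lambda_0},\mathcal{G})=\mu_0(f_{\lambda_0},\mathcal{F})$.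
   Formalization: For k=ℓ, (iii)⇒(i) and (iii)⇒μ≤k assume some D_i(f)(0)≠0, i≤ℓ; (iv)⇒(i) assumes some D_i(f)(0)≠0, i≤k, or the rank condition also for k+1; the rank condition includes λ_0 interior to Λ and α_i C^1 near λ_0; D_j f_λ(x) is continuous in λ for each x in [0,d). *)

theory Defs
  imports "HOL-Analysis.Analysis" "Jordan_Normal_Form.DL_Rank"
begin

definition Cr_on :: "enat \<Rightarrow> real set \<Rightarrow> (real \<Rightarrow> real) \<Rightarrow> bool" where
  "Cr_on r S h \<longleftrightarrow>
     (\<forall>n. enat n \<le> r \<longrightarrow> continuous_on S ((deriv ^^ n) h)) \<and>
     (\<forall>n. enat (Suc n) \<le> r \<longrightarrow> (\<forall>x\<in>S. (deriv ^^ n) h differentiable (at x)))"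

text \<open>The operators \<open>D\<^sub>i\<close>; only the values on \<open>(0,d)\<close> are meaningful here.\<close>

primrec gderiv :: "(nat \<Rightarrow> real \<Rightarrow> real) \<Rightarrow> nat \<Rightarrow> (real \<Rightarrow> real) \<Rightarrow> real \<Rightarrow> real" where
  "gderiv u 0 h = (\<lambda>x. h x / u 0 x)"
| "gderiv u (Suc i) h = (\<lambda>x. deriv (gderiv u i h) x / deriv (gderiv u i (u (Suc i))) x)"

text \<open>\<open>D\<^sub>i\<close> extended to \<open>x = 0\<close> by its limit.\<close>

definition gderiv0 :: "(nat \<Rightarrow> real \<Rightarrow> real) \<Rightarrow> nat \<Rightarrow> (real \<Rightarrow> real) \<Rightarrow> real \<Rightarrow> real" where
  "gderiv0 u i h x = (if x = 0 then Lim (at_right 0) (gderiv u i h) else gderiv u i h x)"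

text \<open>\<open>D\<^sub>0 h, \<dots>, D\<^sub>l h\<close> are well defined on \<open>(0,d)\<close> (all derivatives in the recursion exist and no
  denominator vanishes) and have finite limits at \<open>0\<close>.\<close>

definition gderivs_defined :: "real \<Rightarrow> nat \<Rightarrow> (nat \<Rightarrow> real \<Rightarrow> real) \<Rightarrow> (real \<Rightarrow> real) \<Rightarrow> bool" where
  "gderivs_defined d l u h \<longleftrightarrow>
     (\<forall>x\<in>{0<..<d}. u 0 x \<noteq> 0) \<and>
     (\<forall>i<l. \<forall>x\<in>{0<..<d}.
        gderiv u i h differentiable (at x) \<and>
        gderiv u i (u (Suc i)) differentiable (at x) \<and>
        deriv (gderiv u i (u (Suc i))) x \<noteq> 0) \<and>
     (\<forall>i\<le>l. \<exists>L. (gderiv u i h \<longlongrightarrow> L) (at_right 0))"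

definition chebyshev_scale :: "real \<Rightarrow> enat \<Rightarrow> nat \<Rightarrow> (nat \<Rightarrow> real \<Rightarrow> real) \<Rightarrow> bool" where
  "chebyshev_scale d r l u \<longleftrightarrow>
     (\<forall>k\<le>l. continuous_on {0..<d} (u k) \<and> Cr_on r {0<..<d} (u k)) \<and>
     (\<forall>k\<le>l. gderivs_defined d l u (u k)) \<and>
     (\<forall>i<l. strict_mono_on {0..<d} (gderiv0 u i (u (Suc i)))) \<and>
     (\<forall>i\<le>l. \<forall>j<i. (gderiv u j (u i) \<longlongrightarrow> 0) (at_right 0))"

definition has_development ::
  "real \<Rightarrow> nat \<Rightarrow> (nat \<Rightarrow> real \<Rightarrow> real) \<Rightarrow> (real \<Rightarrow> real) \<Rightarrow> (nat \<Rightarrow> real) \<Rightarrow> (real \<Rightarrow> real) \<Rightarrow> bool" where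
  "has_development d l u h a \<psi> \<longleftrightarrow>
     (\<forall>x\<in>{0..<d}. h x = (\<Sum>i\<le>l. a i * u i x) + \<psi> x) \<and>
     gderivs_defined d l u \<psi> \<and>
     (\<forall>i\<le>l. (gderiv u i \<psi> \<longlongrightarrow> 0) (at_right 0))"

text \<open>The parameter space is an arbitrary topological space \<open>T\<close>. The extension that depends
  continuously on the parameter is the extended function on \<open>[0,d)\<close>, not only its value at \<open>0\<close>.\<close>

definition uniform_development ::
  "'l topology \<Rightarrow> real \<Rightarrow> nat \<Rightarrow> ('l \<Rightarrow> nat \<Rightarrow> real \<Rightarrow> real) \<Rightarrow> ('l \<Rightarrow> real \<Rightarrow> real) \<Rightarrow>
     (nat \<Rightarrow> 'l \<Rightarrow> real) \<Rightarrow> ('l \<Rightarrow> real \<Rightarrow> real) \<Rightarrow> bool" where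
  "uniform_development T d l u f \<alpha> \<psi> \<longleftrightarrow>
     (\<forall>lam\<in>topspace T. has_development d l (u lam) (f lam) (\<lambda>i. \<alpha> i lam) (\<psi> lam)) \<and>
     (\<forall>j\<le>l.
        uniform_limit (topspace T) (\<lambda>x lam. gderiv (u lam) j (f lam) x)
          (\<lambda>lam. gderiv0 (u lam) j (f lam) 0) (at_right 0) \<and>
        (\<forall>x\<in>{0..<d}. continuous_map T euclideanreal (\<lambda>lam. gderiv0 (u lam) j (f lam) x)))"

definition comparable_at_0 :: "(real \<Rightarrow> real) \<Rightarrow> (real \<Rightarrow> real) \<Rightarrow> bool" where
  "comparable_at_0 F G \<longleftrightarrow>
     (\<exists>A>0. \<exists>B>0. \<exists>\<delta>>0. \<forall>x\<in>{0<..<\<delta>}. A \<le> F x / G x \<and> F x / G x \<le> B)"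

definition orbit_of :: "(real \<Rightarrow> real) \<Rightarrow> real \<Rightarrow> real set" where
  "orbit_of g x0 = range (\<lambda>n. (g ^^ n) x0)"

definition in_basin :: "real \<Rightarrow> (real \<Rightarrow> real) \<Rightarrow> real \<Rightarrow> bool" where
  "in_basin d g x0 \<longleftrightarrow>
     (\<forall>n. (g ^^ n) x0 \<in> {0<..<d}) \<and> decseq (\<lambda>n. (g ^^ n) x0) \<and> (\<lambda>n. (g ^^ n) x0) \<longlonglongrightarrow> 0"

definition nbhd_length :: "real set \<Rightarrow> real \<Rightarrow> real" where
  "nbhd_length U \<epsilon> = measure lebesgue (\<Union>y\<in>U. ball y \<epsilon>)"

text \<open>The inverse is that of the function restricted to \<open>(0,d)\<close>. The contents may be infinite.\<close>

definition lower_content :: "real \<Rightarrow> real set \<Rightarrow> (real \<Rightarrow> real) \<Rightarrow> ereal" where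
  "lower_content d U v =
     Liminf (at_right 0) (\<lambda>\<epsilon>. ereal (nbhd_length U \<epsilon> / inv_into {0<..<d} v \<epsilon>))"

definition upper_content :: "real \<Rightarrow> real set \<Rightarrow> (real \<Rightarrow> real) \<Rightarrow> ereal" where
  "upper_content d U v =
     Limsup (at_right 0) (\<lambda>\<epsilon>. ereal (nbhd_length U \<epsilon> / inv_into {0<..<d} v \<epsilon>))"

definition is_greatest :: "nat set \<Rightarrow> nat \<Rightarrow> bool" where
  "is_greatest A k \<longleftrightarrow> k \<in> A \<and> (\<forall>i\<in>A. i \<le> k)"

text \<open>The lower and the upper critical order both exist and are equal to \<open>k\<close>.\<close>

definition critical_order_is ::
  "real \<Rightarrow> nat \<Rightarrow> (nat \<Rightarrow> real \<Rightarrow> real) \<Rightarrow> (real \<Rightarrow> real) \<Rightarrow> real \<Rightarrow> nat \<Rightarrow> bool" where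
  "critical_order_is d l u g x0 k \<longleftrightarrow>
     is_greatest {i\<in>{1..l}. lower_content d (orbit_of g x0) (u i) > 0} k \<and>
     is_greatest {i\<in>{1..l}. upper_content d (orbit_of g x0) (u i) > 0} k"

definition zero_mult_ge :: "'l topology \<Rightarrow> real \<Rightarrow> ('l \<Rightarrow> real \<Rightarrow> real) \<Rightarrow> 'l \<Rightarrow> nat \<Rightarrow> bool" where
  "zero_mult_ge T d f lam0 p \<longleftrightarrow>
     (\<exists>s y. (\<forall>n. s n \<in> topspace T) \<and> limitin T s lam0 sequentially \<and>
        (\<forall>n. inj_on (y n) {1..p} \<and>
             (\<forall>j\<in>{1..p}. y n j \<in> {0..<d} \<and> y n j \<noteq> 0 \<and> f (s n) (y n j) = 0)) \<and>
        (\<forall>j\<in>{1..p}. (\<lambda>n::nat. y n j) \<longlonglongrightarrow> 0))"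

text \<open>The multiplicity is \<open>\<infinity>\<close> if there is no largest \<open>p\<close>.\<close>

definition zero_mult :: "'l topology \<Rightarrow> real \<Rightarrow> ('l \<Rightarrow> real \<Rightarrow> real) \<Rightarrow> 'l \<Rightarrow> enat" where
  "zero_mult T d f lam0 = Sup {enat p | p. zero_mult_ge T d f lam0 p}"

definition fix_mult :: "'l topology \<Rightarrow> real \<Rightarrow> ('l \<Rightarrow> real \<Rightarrow> real) \<Rightarrow> 'l \<Rightarrow> enat" where
  "fix_mult T d g lam0 = zero_mult T d (\<lambda>lam x. x - g lam x) lam0"

definition partial_deriv :: "(real ^ 'n \<Rightarrow> real) \<Rightarrow> 'n \<Rightarrow> real ^ 'n \<Rightarrow> real" where
  "partial_deriv a j p = deriv (\<lambda>t. a (p + t *\<^sub>R axis j 1)) 0"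

definition C1_near :: "(real ^ 'n) set \<Rightarrow> (real ^ 'n \<Rightarrow> real) \<Rightarrow> real ^ 'n \<Rightarrow> bool" where
  "C1_near U a p \<longleftrightarrow>
     (\<exists>V. open V \<and> p \<in> V \<and> V \<subseteq> U \<and> (\<forall>q\<in>V. a differentiable (at q)) \<and>
        (\<forall>j. continuous_on V (partial_deriv a j)))"

text \<open>The parameter space is identified with a subset of \<open>\<real>\<^sup>N\<close>, \<open>N = CARD('n)\<close>, by the embedding
  \<open>c\<close> (the inclusion, if it is a subset to begin with), and \<open>e\<close> numbers the coordinates as
  \<open>1, \<dots>, N\<close>. The \<open>p \<times> p\<close> matrix is indexed from \<open>0\<close>, so its column \<open>j\<close> belongs to the parameter
  number \<open>j + 1\<close>. That the coefficients are continuously differentiable around \<open>lam0\<close>, an interior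
  point, is part of the condition.\<close>

definition regular_params ::
  "'l topology \<Rightarrow> ('l \<Rightarrow> real ^ 'n) \<Rightarrow> (nat \<Rightarrow> 'n) \<Rightarrow> (nat \<Rightarrow> 'l \<Rightarrow> real) \<Rightarrow> 'l \<Rightarrow> nat \<Rightarrow> bool" where
  "regular_params T c e \<alpha> lam0 p \<longleftrightarrow>
     embedding_map T euclidean c \<and>
     bij_betw e {1..CARD('n)} UNIV \<and> p \<le> CARD('n) \<and>
     (\<forall>i<p. C1_near (c ` topspace T) (\<lambda>q. \<alpha> i (inv_into (topspace T) c q)) (c lam0)) \<and>
     vec_space.rank p
       (Matrix.mat p p (\<lambda>(i, j).
          partial_deriv (\<lambda>q. \<alpha> i (inv_into (topspace T) c q)) (e (Suc j)) (c lam0))) = p"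

end

theory Submission
  imports Defs
begin

text \<open>Everything is decided by the first nonzero coefficient of \<open>f = f\<^sub>\<lambda>\<^sub>0\<close> in the scale.

By linearity, \<open>D\<^sub>i f(0) = \<alpha>\<^sub>i\<close>, and L'Hospital's rule along the recursion of the operators shows that
\<open>f / u\<^sub>p\<close> tends to \<open>\<alpha>\<^sub>p\<close> if the coefficients before \<open>\<alpha>\<^sub>p\<close> vanish
(\<open>development_quotient_tendsto\<close>). Since \<open>u\<^sub>j = o(u\<^sub>i)\<close> for \<open>i < j\<close>, the condition (i) means that \<open>f\<close>
and \<open>u\<^sub>k\<close> are comparable.

The orbit sees the growth of \<open>f\<close>: its neighbourhood of radius \<open>f(x)\<close> has length comparable to \<open>x\<close>
(\<open>orbit_nbhd_length_comparable\<close>). The bounds on the logarithmic derivative make \<open>f\<close> grow like a power, so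
that a constant factor in the radius only costs a constant factor in \<open>x\<close>. Hence
the length at radius \<open>u\<^sub>i(x)\<close> is comparable to \<open>x\<close> exactly if \<open>u\<^sub>i\<close> and \<open>f\<close> are comparable, it is
\<open>o(x)\<close> if \<open>u\<^sub>i = o(f)\<close>, and it is at least a multiple of \<open>x\<close> if \<open>f = O(u\<^sub>i)\<close>. With the substitution
\<open>\<epsilon> = u\<^sub>i(x)\<close> this gives (ii) and (iii).

For the multiplicity, Rolle's theorem turns \<open>k + 1\<close> small zeros of \<open>f\<^sub>\<lambda>\<close> into a small zero of
\<open>D\<^sub>k f\<^sub>\<lambda>\<close>; this is impossible for \<open>\<lambda>\<close> near \<open>\<lambda>\<^sub>0\<close> if \<open>\<alpha>\<^sub>k(\<lambda>\<^sub>0) \<noteq> 0\<close>, by the uniformity of the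
development (\<open>zero_mult_bound\<close>). Conversely, if \<open>\<alpha>\<^sub>0, \<dots>, \<alpha>\<^sub>p\<^sub>-\<^sub>1\<close> vanish at \<open>\<lambda>\<^sub>0\<close> and their Jacobian is
regular, the inverse function theorem allows one to choose these coefficients freely, and \<open>p\<close> zeros are created
one by one by giving alternating signs to \<open>\<alpha>\<^sub>p\<^sub>-\<^sub>1, \<dots>, \<alpha>\<^sub>0\<close>, each much smaller than the one before
(\<open>zero_mult_ge_if_regular\<close>).\<close>

section \<open>Generalized derivatives in a Chebyshev scale\<close>

lemma eventually_at_right_0I:
  fixes d :: real
  assumes "d > 0" "\<And>x. x \<in> {0<..<d} \<Longrightarrow> P x"
  shows "eventually P (at_right 0)"
  using assms eventually_at_rightI[of 0 d P] by blast

lemma pos_if_deriv_pos_and_tendsto_0: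
  fixes h :: "real \<Rightarrow> real"
  assumes deriv: "\<And>x. x \<in> {0<..<d} \<Longrightarrow> (h has_real_derivative h' x) (at x)"
    and pos: "\<And>x. x \<in> {0<..<d} \<Longrightarrow> h' x > 0"
    and lim: "(h \<longlongrightarrow> 0) (at_right 0)"
    and x: "x \<in> {0<..<d}"
  shows "h x > 0"
proof -
  have less: "h a < h b" if "0 < a" "a < b" "b < d" for a b
  proof (rule DERIV_pos_imp_increasing[OF that(2)])
    fix y assume "a \<le> y" "y \<le> b"
    then have "y \<in> {0<..<d}" using that by auto
    then show "\<exists>z. (h has_real_derivative z) (at y) \<and> 0 < z" using deriv pos by blast
  qed
  have "0 \<le> h (x/2)"
  proof (rule tendsto_upperbound[OF lim])
    show "eventually (\<lambda>y. h y \<le> h (x/2)) (at_right 0)"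
      by (rule eventually_at_right_0I[of "x/2"]) (use x less in \<open>auto intro!: less_imp_le less\<close>)
  qed simp
  also have "\<dots> < h x" using x by (intro less) auto
  finally show ?thesis .
qed

text \<open>The hypothesis is on \<open>(0,d)\<close> only, since a development says nothing outside \<open>[0,d)\<close>; this is
enough because all derivatives are taken at interior points.\<close>

lemma gderiv_cong:
  assumes "\<And>x. x \<in> {0<..<d} \<Longrightarrow> h x = h' x" and "x \<in> {0<..<d}"
  shows "gderiv u i h x = gderiv u i h' x"
  using assms(2)
proof (induction i arbitrary: x)
  case 0
  then show ?case using assms(1) by simp
next
  case (Suc i)
  have "eventually (\<lambda>y. gderiv u i h y = gderiv u i h' y) (nhds x)"
    using Suc eventually_nhds_in_open[of "{0<..<d}" x]
    by (auto elim!: eventually_mono)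
  then have "deriv (gderiv u i h) x = deriv (gderiv u i h') x"
    by (intro deriv_cong_ev) auto
  then show ?case by simp
qed

lemma gderivs_defined_has_deriv:
  assumes "gderivs_defined d l u h" "i < l" "x \<in> {0<..<d}"
  shows "(gderiv u i h has_real_derivative deriv (gderiv u i h) x) (at x)"
  using assms DERIV_deriv_iff_real_differentiable unfolding gderivs_defined_def by blast

lemma gderiv_sum:
  assumes "\<And>s. s \<in> S \<Longrightarrow> gderivs_defined d l u (h s)" "i \<le> l" "x \<in> {0<..<d}"
  shows "gderiv u i (\<lambda>x. \<Sum>s\<in>S. a s * h s x) x = (\<Sum>s\<in>S. a s * gderiv u i (h s) x)"
  using assms(2,3)
proof (induction i arbitrary: x)
  case 0
  then show ?case by (simp add: sum_divide_distrib)
next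
  case (Suc i)
  have "((\<lambda>x. \<Sum>s\<in>S. a s * gderiv u i (h s) x) has_real_derivative
          (\<Sum>s\<in>S. a s * deriv (gderiv u i (h s)) x)) (at x)"
    using Suc.prems assms(1)
    by (intro DERIV_sum DERIV_cmult gderivs_defined_has_deriv) auto
  then have "(gderiv u i (\<lambda>x. \<Sum>s\<in>S. a s * h s x) has_real_derivative
          (\<Sum>s\<in>S. a s * deriv (gderiv u i (h s)) x)) (at x)"
    by (rule has_field_derivative_transform_within_open[where S = "{0<..<d}"])
      (use Suc in auto)
  then show ?case by (simp add: DERIV_imp_deriv sum_divide_distrib)
qed

context
  fixes d :: real and r :: enat and l :: nat and u :: "nat \<Rightarrow> real \<Rightarrow> real"
  assumes d: "d > 0" and cheb: "chebyshev_scale d r l u"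
begin

lemma scale_gderivs_defined: "k \<le> l \<Longrightarrow> gderivs_defined d l u (u k)"
  using cheb by (simp add: chebyshev_scale_def)

lemma scale_u0_nonzero: "x \<in> {0<..<d} \<Longrightarrow> u 0 x \<noteq> 0"
  using scale_gderivs_defined[of 0] by (simp add: gderivs_defined_def)

text \<open>Strict monotonicity only gives a nonnegative derivative; it is the well-definedness of the next
operator that makes it nonzero. All later sign arguments rest on this positive weight: by
\<open>D\<^sub>i\<^sub>+\<^sub>1 h = (D\<^sub>i h)' / (D\<^sub>i u\<^sub>i\<^sub>+\<^sub>1)'\<close>, the function \<open>D\<^sub>i\<^sub>+\<^sub>1 h\<close> has the sign of \<open>(D\<^sub>i h)'\<close>.\<close>

lemma scale_weight_pos:
  assumes i: "i < l" and x: "x \<in> {0<..<d}"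
  shows "deriv (gderiv u i (u (Suc i))) x > 0"
proof -
  have def: "gderivs_defined d l u (u (Suc i))" using i by (intro scale_gderivs_defined) auto
  have "strict_mono_on {0..<d} (gderiv0 u i (u (Suc i)))"
    using cheb i by (simp add: chebyshev_scale_def)
  then have "mono_on {0<..<d} (gderiv u i (u (Suc i)))"
    by (fastforce simp: monotone_on_def gderiv0_def strict_mono_on_def less_eq_real_def)
  then have "deriv (gderiv u i (u (Suc i))) x \<ge> 0"
    using mono_on_imp_deriv_nonneg[OF _ gderivs_defined_has_deriv[OF def i x]] x by simp
  moreover have "deriv (gderiv u i (u (Suc i))) x \<noteq> 0"
    using def i x by (simp add: gderivs_defined_def)
  ultimately show ?thesis by linarith
qed

lemma deriv_gderiv_eq:
  assumes "i < l" "x \<in> {0<..<d}"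
  shows "deriv (gderiv u i h) x = gderiv u (Suc i) h x * deriv (gderiv u i (u (Suc i))) x"
  using scale_weight_pos[OF assms] by simp

lemma gderiv_scale_diagonal:
  assumes "i \<le> l" "x \<in> {0<..<d}"
  shows "gderiv u i (u i) x = 1"
proof (cases i)
  case 0
  then show ?thesis using scale_u0_nonzero assms by simp
next
  case (Suc j)
  then show ?thesis using scale_weight_pos[of j x] assms by simp
qed

lemma gderiv_scale_below_diagonal:
  assumes "j < i" "i \<le> l" "x \<in> {0<..<d}"
  shows "gderiv u i (u j) x = 0"
  using assms
proof (induction i arbitrary: x)
  case 0
  then show ?case by simp
next
  case (Suc i)
  \<comment> \<open>\<open>D\<^sub>i u\<^sub>j\<close> is constant: it is \<open>1\<close> if \<open>i = j\<close> and \<open>0\<close> afterwards.\<close>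
  have const: "gderiv u i (u j) y = (if i = j then 1 else 0)" if "y \<in> {0<..<d}" for y
    using that Suc gderiv_scale_diagonal[of i y] by auto
  have "eventually (\<lambda>y. gderiv u i (u j) y = (if i = j then 1 else 0)) (nhds x)"
    using const eventually_nhds_in_open[of "{0<..<d}" x] Suc.prems
    by (auto elim!: eventually_mono)
  then have "deriv (gderiv u i (u j)) x = deriv (\<lambda>_. if i = j then 1 else 0) x"
    by (intro deriv_cong_ev) auto
  then show ?case by simp
qed

text \<open>Descending induction from \<open>D\<^sub>k u\<^sub>k = 1\<close>: if \<open>D\<^sub>i\<^sub>+\<^sub>1 u\<^sub>k > 0\<close>, then \<open>D\<^sub>i u\<^sub>k\<close> is increasing, and it tends
to \<open>0\<close> at the origin.\<close>

lemma gderiv_scale_pos: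
  assumes "i \<le> k" "k \<le> l" "x \<in> {0<..<d}"
  shows "gderiv u i (u k) x > 0"
  using assms(1,3)
proof (induction i arbitrary: x rule: inc_induct)
  case base
  then show ?case using gderiv_scale_diagonal assms by simp
next
  case (step n)
  have n: "n < l" using step assms by simp
  show ?case
  proof (rule pos_if_deriv_pos_and_tendsto_0[OF _ _ _ step.prems])
    show "(gderiv u n (u k) has_real_derivative deriv (gderiv u n (u k)) y) (at y)"
      if "y \<in> {0<..<d}" for y
      using gderivs_defined_has_deriv[OF scale_gderivs_defined n that] assms by simp
    show "0 < deriv (gderiv u n (u k)) y" if "y \<in> {0<..<d}" for y
      unfolding deriv_gderiv_eq[OF n that, of "u k"]
      using step.IH[OF that] scale_weight_pos[OF n that] by (rule mult_pos_pos)
    show "(gderiv u n (u k) \<longlongrightarrow> 0) (at_right 0)"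
      using cheb step assms by (simp add: chebyshev_scale_def)
  qed
qed

text \<open>L'Hospital's rule, applied \<open>k\<close> times to \<open>D\<^sub>i h / D\<^sub>i u\<^sub>k\<close>: the weight cancels in the quotient of the
derivatives, which leaves \<open>D\<^sub>i\<^sub>+\<^sub>1 h / D\<^sub>i\<^sub>+\<^sub>1 u\<^sub>k\<close>, and the last quotient is \<open>D\<^sub>k h\<close>, since
\<open>D\<^sub>k u\<^sub>k = 1\<close>.\<close>

lemma quotient_tendsto_gderiv:
  assumes h: "gderivs_defined d l u h" and k: "k \<le> l"
    and zero: "\<And>j. j < k \<Longrightarrow> (gderiv u j h \<longlongrightarrow> 0) (at_right 0)"
    and lim: "(gderiv u k h \<longlongrightarrow> a) (at_right 0)"
  shows "((\<lambda>x. h x / u k x) \<longlongrightarrow> a) (at_right 0)"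
proof -
  have "((\<lambda>x. gderiv u i h x / gderiv u i (u k) x) \<longlongrightarrow> a) (at_right 0)" if "i \<le> k" for i
    using that
  proof (induction i rule: inc_induct)
    case base
    have "eventually (\<lambda>x. gderiv u k h x = gderiv u k h x / gderiv u k (u k) x) (at_right 0)"
      by (rule eventually_at_right_0I[OF d]) (use gderiv_scale_diagonal k in auto)
    then show ?case using lim by (rule Lim_transform_eventually[rotated])
  next
    case (step n)
    have n: "n < l" using step k by simp
    have quot: "deriv (gderiv u n h) x / deriv (gderiv u n (u k)) x
        = gderiv u (Suc n) h x / gderiv u (Suc n) (u k) x" if "x \<in> {0<..<d}" for x
      unfolding deriv_gderiv_eq[OF n that, of h] deriv_gderiv_eq[OF n that, of "u k"]
      using scale_weight_pos[OF n that] by simp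
    show ?case
    proof (rule lhopital_right_0)
      show "(gderiv u n h \<longlongrightarrow> 0) (at_right 0)" using zero step by simp
      show "(gderiv u n (u k) \<longlongrightarrow> 0) (at_right 0)"
        using cheb step k by (simp add: chebyshev_scale_def)
      show "eventually (\<lambda>x. gderiv u n (u k) x \<noteq> 0) (at_right 0)"
        by (rule eventually_at_right_0I[OF d]) (use gderiv_scale_pos[of n k] k step in force)
      show "eventually (\<lambda>x. deriv (gderiv u n (u k)) x \<noteq> 0) (at_right 0)"
      proof (rule eventually_at_right_0I[OF d])
        fix x assume x: "x \<in> {0<..<d}"
        show "deriv (gderiv u n (u k)) x \<noteq> 0"
          unfolding deriv_gderiv_eq[OF n x, of "u k"]
          using scale_weight_pos[OF n x] gderiv_scale_pos[of "Suc n" k x] k step.hyps x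
          by (simp del: gderiv.simps)
      qed
      show "eventually (\<lambda>x. (gderiv u n h has_real_derivative deriv (gderiv u n h) x) (at x)) (at_right 0)"
        by (rule eventually_at_right_0I[OF d]) (rule gderivs_defined_has_deriv[OF h n])
      show "eventually (\<lambda>x. (gderiv u n (u k) has_real_derivative deriv (gderiv u n (u k)) x) (at x)) (at_right 0)"
        by (rule eventually_at_right_0I[OF d])
          (rule gderivs_defined_has_deriv[OF scale_gderivs_defined[OF k] n])
      have "eventually (\<lambda>x. gderiv u (Suc n) h x / gderiv u (Suc n) (u k) x =
          deriv (gderiv u n h) x / deriv (gderiv u n (u k)) x) (at_right 0)"
        by (rule eventually_at_right_0I[OF d]) (rule quot[symmetric])
      then show "((\<lambda>x. deriv (gderiv u n h) x / deriv (gderiv u n (u k)) x) \<longlongrightarrow> a) (at_right 0)"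
        using step.IH by (rule Lim_transform_eventually[rotated])
    qed
  qed
  from this[of 0] have *: "((\<lambda>x. (h x / u 0 x) / (u k x / u 0 x)) \<longlongrightarrow> a) (at_right 0)" by simp
  have "eventually (\<lambda>x. (h x / u 0 x) / (u k x / u 0 x) = h x / u k x) (at_right 0)"
    by (rule eventually_at_right_0I[OF d]) (use scale_u0_nonzero in auto)
  then show ?thesis using * by (rule Lim_transform_eventually[rotated])
qed

lemma scale_quotient_tendsto_0:
  assumes "i < j" "j \<le> l"
  shows "((\<lambda>x. u j x / u i x) \<longlongrightarrow> 0) (at_right 0)"
  using quotient_tendsto_gderiv[of "u j" i 0] scale_gderivs_defined[of j] assms cheb
  by (simp add: chebyshev_scale_def)

text \<open>The scale consists of small functions because \<open>u\<^sub>0\<close>, being continuous at \<open>0\<close>, is bounded there.\<close>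

lemma scale_tendsto_0:
  assumes "0 < j" "j \<le> l"
  shows "(u j \<longlongrightarrow> 0) (at_right 0)"
proof -
  have "continuous_on {0..<d} (u 0)" using cheb by (simp add: chebyshev_scale_def)
  then have "continuous_on {0..d/2} (u 0)" by (rule continuous_on_subset) (use d in auto)
  then have "(u 0 \<longlongrightarrow> u 0 0) (at 0 within {0..d/2})" using d by (simp add: continuous_on_def)
  then have "(u 0 \<longlongrightarrow> u 0 0) (at_right 0)" using d by (simp add: at_within_Icc_at_right)
  with scale_quotient_tendsto_0[OF assms]
  have *: "((\<lambda>x. u j x / u 0 x * u 0 x) \<longlongrightarrow> 0 * u 0 0) (at_right 0)" by (rule tendsto_mult)
  have "eventually (\<lambda>x. u j x / u 0 x * u 0 x = u j x) (at_right 0)"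
    by (rule eventually_at_right_0I[OF d]) (use scale_u0_nonzero in auto)
  then show ?thesis using * by (auto dest: Lim_transform_eventually)
qed

text \<open>By linearity, \<open>D\<^sub>i h\<close> is the combination of the \<open>D\<^sub>i u\<^sub>s\<close> and \<open>D\<^sub>i \<psi>\<close>. Of their limits at \<open>0\<close>, only that of
\<open>D\<^sub>i u\<^sub>i = 1\<close> is nonzero.\<close>

lemma development_gderivs:
  assumes dev: "has_development d l u h a \<psi>"
  shows "i \<le> l \<Longrightarrow> (gderiv u i h \<longlongrightarrow> a i) (at_right 0)" and "gderivs_defined d l u h"
proof -
  \<comment> \<open>The remainder is treated as a further term, with coefficient \<open>1\<close>.\<close>
  define b where "b s = (if s \<le> l then u s else \<psi>)" for s
  define a' where "a' s = (if s \<le> l then a s else 1)" for s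
  have eq: "h x = (\<Sum>s\<le>Suc l. a' s * b s x)" if "x \<in> {0<..<d}" for x
    using dev that by (simp add: has_development_def a'_def b_def)
  have b: "gderivs_defined d l u (b s)" for s
    using scale_gderivs_defined dev by (simp add: b_def has_development_def)
  have lim_b: "(gderiv u i (b s) \<longlongrightarrow> (if s = i then 1 else 0)) (at_right 0)" if i: "i \<le> l" for i s
  proof -
    consider "s > l" | "s \<le> l" "s < i" | "s \<le> l" "s = i" | "s \<le> l" "s > i" by linarith
    then show ?thesis
    proof cases
      case 1
      then show ?thesis using dev i by (simp add: has_development_def b_def)
    next
      case 2
      have "eventually (\<lambda>x. gderiv u i (b s) x = 0) (at_right 0)"
        by (rule eventually_at_right_0I[OF d]) (use gderiv_scale_below_diagonal 2 i in \<open>simp add: b_def\<close>)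
      then show ?thesis using 2 by (simp add: tendsto_eventually)
    next
      case 3
      have "eventually (\<lambda>x. gderiv u i (b s) x = 1) (at_right 0)"
        by (rule eventually_at_right_0I[OF d]) (use gderiv_scale_diagonal 3 i in \<open>simp add: b_def\<close>)
      then show ?thesis using 3 by (simp add: tendsto_eventually)
    next
      case 4
      then show ?thesis using cheb by (simp add: chebyshev_scale_def b_def)
    qed
  qed
  have gd: "gderiv u i h x = (\<Sum>s\<le>Suc l. a' s * gderiv u i (b s) x)"
    if "i \<le> l" "x \<in> {0<..<d}" for i x
    using gderiv_cong[of d h _ x u i, OF eq that(2)] gderiv_sum[of "{..Suc l}" d l u b i x a'] b that
    by simp
  show lim: "(gderiv u i h \<longlongrightarrow> a i) (at_right 0)" if i: "i \<le> l" for i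
  proof -
    have "((\<lambda>x. \<Sum>s\<le>Suc l. a' s * gderiv u i (b s) x) \<longlongrightarrow>
            (\<Sum>s\<le>Suc l. a' s * (if s = i then 1 else 0))) (at_right 0)"
      using lim_b[OF i] by (intro tendsto_intros)
    also have "(\<Sum>s\<le>Suc l. a' s * (if s = i then 1 else 0)) = a i"
      using i by (simp add: a'_def if_distrib[of "(*) _"] cong: if_cong del: sum.atMost_Suc)
    finally have *: "((\<lambda>x. \<Sum>s\<le>Suc l. a' s * gderiv u i (b s) x) \<longlongrightarrow> a i) (at_right 0)" .
    have "eventually (\<lambda>x. (\<Sum>s\<le>Suc l. a' s * gderiv u i (b s) x) = gderiv u i h x) (at_right 0)"
      by (rule eventually_at_right_0I[OF d]) (use gd i in simp)
    then show ?thesis using * by (rule Lim_transform_eventually[rotated])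
  qed
  have diff: "gderiv u i h differentiable at x" if "i < l" "x \<in> {0<..<d}" for i x
  proof -
    have "((\<lambda>x. \<Sum>s\<le>Suc l. a' s * gderiv u i (b s) x) has_real_derivative
          (\<Sum>s\<le>Suc l. a' s * deriv (gderiv u i (b s)) x)) (at x)"
      by (intro DERIV_sum DERIV_cmult gderivs_defined_has_deriv[OF b] that)
    then have "(gderiv u i h has_real_derivative
          (\<Sum>s\<le>Suc l. a' s * deriv (gderiv u i (b s)) x)) (at x)"
      by (rule has_field_derivative_transform_within_open[where S = "{0<..<d}"])
        (use gd that in auto)
    then show ?thesis using real_differentiable_def by blast
  qed
  show "gderivs_defined d l u h"
    unfolding gderivs_defined_def
    using diff lim scale_u0_nonzero b[of 0]
    by (auto simp: gderivs_defined_def)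
qed

lemma development_quotient_tendsto:
  assumes dev: "has_development d l u h a \<psi>" and k: "k \<le> l"
    and zero: "\<And>j. j < k \<Longrightarrow> a j = 0"
  shows "((\<lambda>x. h x / u k x) \<longlongrightarrow> a k) (at_right 0)"
proof (rule quotient_tendsto_gderiv[OF development_gderivs(2)[OF dev] k])
  show "(gderiv u j h \<longlongrightarrow> 0) (at_right 0)" if "j < k" for j
    using development_gderivs(1)[OF dev, of j] zero[OF that] that k by simp
  show "(gderiv u k h \<longlongrightarrow> a k) (at_right 0)" by (rule development_gderivs(1)[OF dev k])
qed

lemma gderiv0_at_0_development:
  assumes "has_development d l u h a \<psi>" "k \<le> l"
  shows "gderiv0 u k h 0 = a k"
  using development_gderivs(1)[OF assms] tendsto_Lim[of "at_right (0::real)"]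
  by (simp add: gderiv0_def)

end

section \<open>Growth under a bounded logarithmic derivative\<close>

locale log_derivative_bounds =
  fixes d m M :: real and f :: "real \<Rightarrow> real"
  assumes d: "d > 0" and m: "m > 1"
    and diff: "\<And>x. x \<in> {0<..<d} \<Longrightarrow> f differentiable (at x)"
    and pos: "\<And>x. x \<in> {0<..<d} \<Longrightarrow> f x > 0"
    and log_deriv: "\<And>x. x \<in> {0<..<d} \<Longrightarrow>
      m \<le> x * deriv (\<lambda>t. ln (f t)) x \<and> x * deriv (\<lambda>t. ln (f t)) x \<le> M"
begin

lemma ln_comp_has_deriv:
  assumes "x \<in> {0<..<d}"
  shows "((\<lambda>t. ln (f t)) has_real_derivative deriv (\<lambda>t. ln (f t)) x) (at x)"
proof -
  obtain D where "(f has_real_derivative D) (at x)"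
    using diff[OF assms] real_differentiable_def by blast
  then have "((\<lambda>t. ln (f t)) has_real_derivative inverse (f x) * D) (at x)"
    using pos[OF assms] by (auto intro!: derivative_eq_intros simp: field_simps)
  then show ?thesis by (simp add: DERIV_imp_deriv)
qed

text \<open>The bounds say that \<open>ln f - m ln\<close> is increasing and \<open>ln f - M ln\<close> is decreasing. So \<open>f\<close> lies
between two powers: a constant factor in the argument costs a constant factor in the value, and
conversely.\<close>

lemma power_growth:
  assumes "0 < x" "x \<le> y" "y < d"
  shows "(y / x) powr m * f x \<le> f y" and "f y \<le> (y / x) powr M * f x"
proof -
  have f: "f x > 0" "f y > 0" using pos assms by auto
  have ln: "((\<lambda>t. ln (f t) - p * ln t) has_real_derivative deriv (\<lambda>t. ln (f t)) t - p / t) (at t)"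
    if "x \<le> t" "t \<le> y" for t p
    using DERIV_diff[OF ln_comp_has_deriv[of t] DERIV_cmult[OF DERIV_ln[of t], of p]] that assms
    by (simp add: divide_inverse)
  have "ln (f x) - m * ln x \<le> ln (f y) - m * ln y"
  proof (rule DERIV_nonneg_imp_nondecreasing[OF assms(2)])
    fix t assume t: "x \<le> t" "t \<le> y"
    have "0 \<le> deriv (\<lambda>t. ln (f t)) t - m / t"
      using log_deriv[of t] t assms by (auto simp: field_simps)
    with ln[OF t] show "\<exists>D. ((\<lambda>t. ln (f t) - m * ln t) has_real_derivative D) (at t) \<and> 0 \<le> D"
      by blast
  qed
  then have "ln ((y / x) powr m * f x) \<le> ln (f y)"
    using f assms by (simp add: ln_mult ln_powr ln_div algebra_simps)
  then show "(y / x) powr m * f x \<le> f y" using f assms by simp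
  have "ln (f x) - M * ln x \<ge> ln (f y) - M * ln y"
  proof (rule DERIV_nonpos_imp_nonincreasing[OF assms(2)])
    fix t assume t: "x \<le> t" "t \<le> y"
    have "deriv (\<lambda>t. ln (f t)) t - M / t \<le> 0"
      using log_deriv[of t] t assms by (auto simp: field_simps)
    with ln[OF t] show "\<exists>D. ((\<lambda>t. ln (f t) - M * ln t) has_real_derivative D) (at t) \<and> D \<le> 0"
      by blast
  qed
  then have "ln (f y) \<le> ln ((y / x) powr M * f x)"
    using f assms by (simp add: ln_mult ln_powr ln_div algebra_simps)
  then show "f y \<le> (y / x) powr M * f x" using f assms by simp
qed

lemma power_growth_strict_mono:
  assumes "0 < x" "x < y" "y < d"
  shows "f x < f y"
proof -
  have "1 powr m < (y / x) powr m" using assms m by (intro powr_less_mono2) auto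
  then have "f x < (y / x) powr m * f x" using pos[of x] assms by simp
  also have "\<dots> \<le> f y" using power_growth(1) assms by simp
  finally show ?thesis .
qed

lemma power_growth_mono: "0 < x \<Longrightarrow> x \<le> y \<Longrightarrow> y < d \<Longrightarrow> f x \<le> f y"
  using power_growth_strict_mono[of x y] by (cases "x = y") auto

end

section \<open>Length of the neighbourhood of an orbit\<close>

text \<open>The increment of the potential \<open>x\<^bsup>1-m\<^esup>\<close> along one step of an orbit. It will bound the number of
steps that the orbit needs to come down to a given point.\<close>

lemma powr_one_minus_diff:
  fixes a b m :: real
  assumes "0 < a" "a < b" "1 < m"
  shows "(m - 1) * b powr (- m) * (b - a) \<le> a powr (1 - m) - b powr (1 - m)"
proof -
  have "((\<lambda>x. x powr (1 - m)) has_real_derivative (1 - m) * x powr (- m)) (at x)"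
    if "a \<le> x" for x
    using has_real_derivative_powr[of x "1 - m"] that assms by simp
  then obtain z where z: "a < z" "z < b"
      "b powr (1 - m) - a powr (1 - m) = (b - a) * ((1 - m) * z powr (- m))"
    using MVT2[OF \<open>a < b\<close>, of "\<lambda>x. x powr (1 - m)" "\<lambda>x. (1 - m) * x powr (- m)"] by auto
  have "b powr (- m) \<le> z powr (- m)"
    using z assms by (intro powr_mono2') auto
  then have "(m - 1) * (b - a) * b powr (- m) \<le> (m - 1) * (b - a) * z powr (- m)"
    using assms by (intro mult_left_mono) auto
  with z show ?thesis by (simp add: algebra_simps)
qed

lemma lmeasurable_nbhd:
  fixes U :: "real set"
  assumes "bounded U"
  shows "(\<Union>y\<in>U. ball y e) \<in> lmeasurable"
proof (rule lmeasurable_open)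
  obtain c where "\<And>y. y \<in> U \<Longrightarrow> norm y \<le> c" using assms bounded_iff by blast
  then have "norm z \<le> c + e" if "z \<in> (\<Union>y\<in>U. ball y e)" for z
    using that by (force simp: dist_real_def)
  then show "bounded (\<Union>y\<in>U. ball y e)" unfolding bounded_iff by blast
qed auto

lemma nbhd_length_nonneg: "0 \<le> nbhd_length U e"
  by (simp add: nbhd_length_def)

lemma nbhd_length_mono:
  assumes "bounded U" "e \<le> e'"
  shows "nbhd_length U e \<le> nbhd_length U e'"
  unfolding nbhd_length_def
  using assms(2) fmeasurableD[OF lmeasurable_nbhd[OF assms(1)]]
  by (intro measure_mono_fmeasurable lmeasurable_nbhd[OF assms(1)]) fastforce+

context log_derivative_bounds
begin

text \<open>The radius is taken to be \<open>f x\<close>, so that no inverse function is needed. Let \<open>n\<close> be the first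
index with \<open>X n \<le> x\<close>. From there on the gaps of the orbit are at most \<open>f x\<close>, so the balls fill
the interval up to \<open>X n\<close>, whose length is comparable to \<open>x\<close> as \<open>f\<close> is small against the
identity. The first \<open>n\<close> balls have total length \<open>2 n f x\<close>. That this is also \<open>O(x)\<close> follows by
telescoping: each of the first \<open>n\<close> steps increases \<open>X\<^bsup>1-m\<^esup>\<close> by at least
\<open>(m - 1) x\<^bsup>-m\<^esup> f x\<close>, and the final value of this potential is at most \<open>(x/2)\<^bsup>1-m\<^esup>\<close>.\<close>

lemma orbit_nbhd_length_comparable:
  assumes basin: "in_basin d (\<lambda>x. x - f x) x0"
    and half: "eventually (\<lambda>x. f x \<le> x / 2) (at_right 0)"
  shows "\<exists>A>0. \<exists>B>0. eventually (\<lambda>x. A * x \<le> nbhd_length (orbit_of (\<lambda>x. x - f x) x0) (f x) \<and>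
           nbhd_length (orbit_of (\<lambda>x. x - f x) x0) (f x) \<le> B * x) (at_right 0)"
proof -
  define X where "X n = ((\<lambda>x. x - f x) ^^ n) x0" for n
  have X: "X n > 0" "X n < d" for n
    using basin by (auto simp: in_basin_def X_def)
  have dec: "X j \<le> X i" if "i \<le> j" for i j
    using basin that by (auto simp: in_basin_def X_def decseq_def)
  have X0: "X \<longlonglongrightarrow> 0" using basin by (simp add: in_basin_def X_def[abs_def])
  have X_Suc: "X (Suc n) = X n - f (X n)" for n by (simp add: X_def)
  have small: "\<exists>n. X n < z" if "z > 0" for z
    using order_tendstoD(2)[OF X0 that] by (auto simp: eventually_sequentially)
  define U where "U = orbit_of (\<lambda>x. x - f x) x0"
  have U: "U = range X" by (simp add: U_def orbit_of_def X_def[abs_def])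
  have bdd: "bounded U"
    unfolding U bounded_iff using X dec[of 0] by (auto intro!: exI[of _ "X 0"] simp: abs_if dest: less_asym)
  obtain \<delta> where \<delta>: "\<delta> > 0" "\<And>x. 0 < x \<Longrightarrow> x < \<delta> \<Longrightarrow> f x \<le> x / 2"
    using half by (auto simp: eventually_at_right_field)
  obtain n0 where n0: "X n0 < \<delta>" using small \<delta> by blast
  \<comment> \<open>The constant \<open>c\<close> bounds \<open>n f x / x\<close>, by the telescoping argument.\<close>
  define c where "c = 2 powr (m - 1) / (m - 1)"
  define B where "B = 2 + 2 * c"
  have main: "1/2 * x \<le> nbhd_length U (f x) \<and> nbhd_length U (f x) \<le> B * x"
    if x: "x \<in> {0<..<X n0}" for x
  proof -
    have xd: "x < d" "x < \<delta>" using x X[of n0] n0 by auto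
    have fx: "f x > 0" "f x \<le> x / 2" using pos[of x] \<delta>(2)[of x] xd x by auto
    define n where "n = (LEAST n. X n \<le> x)"
    have "\<exists>n. X n \<le> x" using small[of x] x less_imp_le by auto
    then have Xn: "X n \<le> x" unfolding n_def by (rule LeastI_ex)
    have before: "x < X j" if "j < n" for j
      using not_less_Least[of j "\<lambda>n. X n \<le> x"] that by (simp add: n_def)
    have "n > n0" using dec[of n n0] x Xn by (cases "n \<le> n0") auto
    then obtain n' where n': "n = Suc n'" "n' \<ge> n0" by (cases n) auto
    have "f (X n') \<le> X n' / 2" using \<delta>(2) X dec[of n0 n'] n' n0 by force
    then have Xn_half: "X n \<ge> x / 2" using X_Suc[of n'] before[of n'] n' by simp
    have meas: "(\<Union>y\<in>U. ball y (f x)) \<in> lmeasurable"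
      by (rule lmeasurable_nbhd[OF bdd])
    \<comment> \<open>From the \<open>n\<close>-th point on, the gaps are at most \<open>f x\<close>, so that the balls fill an interval.\<close>
    have "{0<..X n} \<subseteq> (\<Union>y\<in>U. ball y (f x))"
    proof
      fix z assume z: "z \<in> {0<..X n}"
      define j where "j = (LEAST j. X j < z)"
      have Xj: "X j < z" unfolding j_def by (rule LeastI_ex) (use small z in auto)
      have "j > n" using dec[of j n] Xj z by (cases "j \<le> n") auto
      then obtain j' where j': "j = Suc j'" "j' \<ge> n" by (cases j) auto
      have z': "z \<le> X j'" using not_less_Least[of j' "\<lambda>j. X j < z"] j' by (simp add: j_def)
      have "f (X j') \<le> f x" using dec[of n j'] j' Xn X[of j'] xd by (intro power_growth_mono) auto
      then have "dist (X j') z < f x" using X_Suc[of j'] j' Xj z' by (simp add: dist_real_def)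
      then show "z \<in> (\<Union>y\<in>U. ball y (f x))" by (auto simp: U)
    qed
    then have "measure lebesgue {0<..X n} \<le> nbhd_length U (f x)"
      unfolding nbhd_length_def using meas by (intro measure_mono_fmeasurable) auto
    then have lower: "X n \<le> nbhd_length U (f x)" using X[of n] by simp
    have sub: "(\<Union>y\<in>U. ball y (f x)) \<subseteq> {- f x<..<X n + f x} \<union> (\<Union>i<n. ball (X i) (f x))"
    proof
      fix z assume "z \<in> (\<Union>y\<in>U. ball y (f x))"
      then obtain i where i: "dist (X i) z < f x" using U by auto
      show "z \<in> {- f x<..<X n + f x} \<union> (\<Union>i<n. ball (X i) (f x))"
      proof (cases "i < n")
        case False
        then show ?thesis using i dec[of n i] X[of i] by (auto simp: dist_real_def)
      qed (use i in auto)
    qed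
    have "nbhd_length U (f x) \<le> measure lebesgue ({- f x<..<X n + f x} \<union> (\<Union>i<n. ball (X i) (f x)))"
      unfolding nbhd_length_def
    proof (rule measure_mono_fmeasurable[OF sub])
      show "{- f x<..<X n + f x} \<union> (\<Union>i<n. ball (X i) (f x)) \<in> lmeasurable"
        by (rule lmeasurable_open) (auto intro!: open_Un bounded_UN)
    qed (use meas in auto)
    also have "\<dots> \<le> measure lebesgue {- f x<..<X n + f x} + measure lebesgue (\<Union>i<n. ball (X i) (f x))"
      by (rule measure_Un_le) (auto intro!: borel_open)
    also have "measure lebesgue (\<Union>i<n. ball (X i) (f x)) \<le> (\<Sum>i<n. measure lebesgue (ball (X i) (f x)))"
      by (rule measure_UNION_le) auto
    also have "(\<Sum>i<n. measure lebesgue (ball (X i) (f x))) = real n * (2 * f x)"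
      using fx by (simp add: ball_eq_greaterThanLessThan)
    also have "measure lebesgue {- f x<..<X n + f x} = X n + 2 * f x"
      using X[of n] fx by simp
    finally have upper: "nbhd_length U (f x) \<le> X n + 2 * f x + 2 * (real n * f x)" by simp
    \<comment> \<open>Since \<open>f\<close> grows at least like the \<open>m\<close>-th power, \<open>X\<^bsup>-m\<^esup> f X\<close> is at least \<open>x\<^bsup>-m\<^esup> f x\<close> before step \<open>n\<close>.\<close>
    have "real j * ((m - 1) * x powr (- m) * f x) \<le> X j powr (1 - m)" if "j \<le> n" for j
      using that
    proof (induction j)
      case 0
      then show ?case by simp
    next
      case (Suc j)
      have j: "x < X j" using before Suc.prems by simp
      have Xj: "X (Suc j) < X j" using X_Suc[of j] pos[of "X j"] X[of j] by simp
      have "x powr (- m) * f x = X j powr (- m) * ((X j / x) powr m * f x)"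
        using j x X[of j] by (simp add: powr_divide powr_minus field_simps)
      also have "\<dots> \<le> X j powr (- m) * f (X j)"
        using power_growth(1)[of x "X j"] j x X[of j] by (intro mult_left_mono) auto
      finally have "(m - 1) * (x powr (- m) * f x) \<le> (m - 1) * (X j powr (- m) * f (X j))"
        using m by (intro mult_left_mono) auto
      also have "\<dots> \<le> X (Suc j) powr (1 - m) - X j powr (1 - m)"
        using powr_one_minus_diff[OF X(1) Xj m] X_Suc[of j] by (simp add: mult.assoc)
      finally show ?case using Suc by (simp add: algebra_simps)
    qed
    from this[of n] have "real n * ((m - 1) * x powr (- m) * f x) \<le> X n powr (1 - m)" by simp
    also have "\<dots> \<le> (x / 2) powr (1 - m)"
      using Xn_half x m by (intro powr_mono2') auto
    also have "\<dots> = x powr (- m) * (x * 2 powr (m - 1))"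
    proof -
      have "x powr (1 - m) = x powr (- m) * x"
        using x by (simp add: powr_diff powr_minus field_simps)
      moreover have "2 powr (1 - m) = inverse (2 powr (m - 1) :: real)"
        by (metis minus_diff_eq powr_minus)
      ultimately show ?thesis using x by (simp add: powr_divide field_simps)
    qed
    finally have "x powr (- m) * (real n * ((m - 1) * f x)) \<le> x powr (- m) * (x * 2 powr (m - 1))"
      by (simp add: algebra_simps)
    then have "real n * ((m - 1) * f x) \<le> x * 2 powr (m - 1)"
      using x by simp
    then have "real n * f x \<le> c * x"
      unfolding c_def using m by (simp add: field_simps)
    then show ?thesis using upper lower Xn_half Xn fx by (simp add: B_def algebra_simps)
  qed
  have "eventually (\<lambda>x. 1/2 * x \<le> nbhd_length U (f x) \<and> nbhd_length U (f x) \<le> B * x) (at_right 0)"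
    by (rule eventually_at_rightI[OF main X(1)])
  moreover have "B > 0" using m by (auto simp: B_def c_def intro!: add_pos_nonneg divide_nonneg_pos)
  ultimately show ?thesis unfolding U_def by (intro exI[of _ "1/2"] exI[of _ B]) auto
qed

end

section \<open>Comparability and contents after substitution\<close>

lemma comparable_at_0_iff_eventually:
  "comparable_at_0 F G \<longleftrightarrow>
     (\<exists>A>0. \<exists>B>0. eventually (\<lambda>x. A \<le> F x / G x \<and> F x / G x \<le> B) (at_right 0))"
  unfolding comparable_at_0_def eventually_at_right_field by fastforce

lemma eventually_at_right_0_scale:
  fixes c :: real
  assumes "eventually P (at_right 0)" "c > 0"
  shows "eventually (\<lambda>x. P (c * x)) (at_right 0)"
proof -
  obtain b where b: "b > 0" "\<And>y. 0 < y \<Longrightarrow> y < b \<Longrightarrow> P y"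
    using assms(1) by (auto simp: eventually_at_right_field)
  show ?thesis
    by (rule eventually_at_rightI[of 0 "b / c"]) (use b assms(2) in \<open>auto simp: field_simps\<close>)
qed

context
  fixes d :: real and v :: "real \<Rightarrow> real"
  assumes d: "d > 0" and cont: "continuous_on {0<..<d} v"
    and mono: "strict_mono_on {0<..<d} v"
    and pos: "\<And>x. x \<in> {0<..<d} \<Longrightarrow> v x > 0"
    and lim: "(v \<longlongrightarrow> 0) (at_right 0)"
begin

text \<open>The substitution \<open>e = v x\<close>. All statements on \<open>v\<^bsup>-1\<^esup>(e)\<close> as \<open>e \<rightarrow> 0\<close> become statements on
\<open>v x\<close> as \<open>x \<rightarrow> 0\<close>; by the intermediate value theorem every small \<open>e > 0\<close> is a value of \<open>v\<close>.\<close>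

lemma eventually_inv_into_iff:
  "eventually (\<lambda>e. P e (inv_into {0<..<d} v e)) (at_right 0) \<longleftrightarrow>
   eventually (\<lambda>x. P (v x) x) (at_right 0)"
proof
  have inv: "inv_into {0<..<d} v (v x) = x" if "x \<in> {0<..<d}" for x
    using that mono by (simp add: strict_mono_on_imp_inj_on)
  {
    assume "eventually (\<lambda>e. P e (inv_into {0<..<d} v e)) (at_right 0)"
    then obtain b where b: "b > 0" "\<And>e. 0 < e \<Longrightarrow> e < b \<Longrightarrow> P e (inv_into {0<..<d} v e)"
      by (auto simp: eventually_at_right_field)
    have "eventually (\<lambda>x. v x < b) (at_right 0)" using order_tendstoD(2)[OF lim b(1)] .
    moreover have "eventually (\<lambda>x. x \<in> {0<..<d}) (at_right 0)"
      using d eventually_at_rightI[of 0 d] by auto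
    ultimately show "eventually (\<lambda>x. P (v x) x) (at_right 0)"
    proof eventually_elim
      case (elim x)
      then show ?case using b(2)[of "v x"] pos[of x] inv[of x] by simp
    qed
  next
    assume "eventually (\<lambda>x. P (v x) x) (at_right 0)"
    then obtain b where b: "b > 0" "\<And>x. 0 < x \<Longrightarrow> x < b \<Longrightarrow> P (v x) x"
      by (auto simp: eventually_at_right_field)
    define z where "z = min b d / 2"
    have z: "0 < z" "z < b" "z < d" using b d by (auto simp: z_def)
    show "eventually (\<lambda>e. P e (inv_into {0<..<d} v e)) (at_right 0)"
    proof (rule eventually_at_rightI[of 0 "v z"])
      fix e assume e: "e \<in> {0<..<v z}"
      have "eventually (\<lambda>x. v x < e \<and> x \<in> {0<..<z}) (at_right 0)"
        using order_tendstoD(2)[OF lim, of e] e z eventually_at_rightI[of 0 z "\<lambda>x. x \<in> {0<..<z}"]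
        by (intro eventually_conj) auto
      then obtain y where y: "v y < e" "0 < y" "y < z"
        using eventually_happens'[of "at_right (0::real)"] by auto
      have "\<exists>x\<ge>y. x \<le> z \<and> v x = e"
        using y e z by (intro IVT' continuous_on_subset[OF cont]) auto
      then obtain x where "y \<le> x" "x \<le> z" "v x = e" by blast
      then show "P e (inv_into {0<..<d} v e)" using b(2)[of x] inv[of x] y z by auto
    qed (use pos z in auto)
  }
qed

lemma comparable_inv_into_iff:
  "comparable_at_0 N (inv_into {0<..<d} v) \<longleftrightarrow>
     (\<exists>A>0. \<exists>B>0. eventually (\<lambda>x. A \<le> N (v x) / x \<and> N (v x) / x \<le> B) (at_right 0))"
proof -
  have "eventually (\<lambda>e. A \<le> N e / inv_into {0<..<d} v e \<and> N e / inv_into {0<..<d} v e \<le> B) (at_right 0)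
      \<longleftrightarrow> eventually (\<lambda>x. A \<le> N (v x) / x \<and> N (v x) / x \<le> B) (at_right 0)" for A B
    by (rule eventually_inv_into_iff[of "\<lambda>e x. A \<le> N e / x \<and> N e / x \<le> B"])
  then show ?thesis unfolding comparable_at_0_iff_eventually by simp
qed

lemma lower_content_posI:
  assumes "A > 0" "eventually (\<lambda>x. A \<le> nbhd_length U (v x) / x) (at_right 0)"
  shows "lower_content d U v > 0"
proof -
  have "eventually (\<lambda>e. A \<le> nbhd_length U e / inv_into {0<..<d} v e) (at_right 0)"
    using assms(2) by (subst eventually_inv_into_iff[of "\<lambda>e x. A \<le> nbhd_length U e / x"])
  then have "ereal A \<le> lower_content d U v"
    unfolding lower_content_def by (intro Liminf_bounded) simp
  then show ?thesis using assms(1) by (metis ereal_less(2) less_le_trans)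
qed

lemma upper_content_nonposI:
  assumes "((\<lambda>x. nbhd_length U (v x) / x) \<longlongrightarrow> 0) (at_right 0)"
  shows "upper_content d U v \<le> 0"
proof -
  have "((\<lambda>e. nbhd_length U e / inv_into {0<..<d} v e) \<longlongrightarrow> 0) (at_right 0)"
    unfolding tendsto_iff
  proof (intro allI impI)
    fix r :: real assume "r > 0"
    then show "eventually (\<lambda>e. dist (nbhd_length U e / inv_into {0<..<d} v e) 0 < r) (at_right 0)"
      using assms unfolding tendsto_iff
      by (subst eventually_inv_into_iff[of "\<lambda>e x. dist (nbhd_length U e / x) 0 < r"]) blast
  qed
  then have "((\<lambda>e. ereal (nbhd_length U e / inv_into {0<..<d} v e)) \<longlongrightarrow> ereal 0) (at_right 0)"
    by simp
  then have "upper_content d U v = ereal 0"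
    unfolding upper_content_def by (intro lim_imp_Limsup) auto
  then show ?thesis by simp
qed

end

lemma lower_content_le_upper_content: "lower_content d U v \<le> upper_content d U v"
  unfolding lower_content_def upper_content_def by (intro Liminf_le_Limsup) simp

section \<open>Reading the growth of a function off the neighbourhood length\<close>

text \<open>The function \<open>N\<close> stands for the neighbourhood length of the orbit, of which only monotonicity,
nonnegativity and the comparison \<open>N (f x) \<simeq> x\<close> matter from here on. As \<open>f\<close> grows like a power, \<open>N (v x) / x\<close> then
tells how \<open>v\<close> compares with \<open>f\<close>.\<close>

locale sampled_content = log_derivative_bounds +
  fixes A\<^sub>0 B\<^sub>0 :: real and N :: "real \<Rightarrow> real"
  assumes A0: "A\<^sub>0 > 0" and B0: "B\<^sub>0 > 0"
    and N_mono: "\<And>e e'. e \<le> e' \<Longrightarrow> N e \<le> N e'"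
    and N_nonneg: "\<And>e. 0 \<le> N e"
    and N_at_f: "eventually (\<lambda>x. A\<^sub>0 * x \<le> N (f x) \<and> N (f x) \<le> B\<^sub>0 * x) (at_right 0)"
begin

lemma power_growth_contract:
  assumes "0 < \<theta>" "\<theta> \<le> 1" "x \<in> {0<..<d}"
  shows "\<theta> powr M * f x \<le> f (\<theta> * x)" "f (\<theta> * x) \<le> \<theta> powr m * f x"
proof -
  have *: "0 < \<theta> * x" "\<theta> * x \<le> x" "x < d" using assms by (auto simp: mult_le_cancel_right1)
  have scale: "(x / (\<theta> * x)) powr p * y \<le> z \<longleftrightarrow> y \<le> \<theta> powr p * z"
    "z \<le> (x / (\<theta> * x)) powr p * y \<longleftrightarrow> \<theta> powr p * z \<le> y" for p y z
  proof -
    define q where "q = \<theta> powr p"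
    have "x / (\<theta> * x) = inverse \<theta>" using assms by (simp add: field_simps)
    then have q: "q > 0" "(x / (\<theta> * x)) powr p = inverse q"
      using assms by (simp_all add: q_def inverse_powr)
    show "(x / (\<theta> * x)) powr p * y \<le> z \<longleftrightarrow> y \<le> \<theta> powr p * z"
      "z \<le> (x / (\<theta> * x)) powr p * y \<longleftrightarrow> \<theta> powr p * z \<le> y"
      unfolding q(2) q_def[symmetric] using q(1) by (simp_all add: field_simps)
  qed
  show "\<theta> powr M * f x \<le> f (\<theta> * x)" "f (\<theta> * x) \<le> \<theta> powr m * f x"
    using power_growth[OF *] unfolding scale by simp_all
qed

lemma power_growth_dilate:
  assumes "1 \<le> \<theta>" "0 < x" "\<theta> * x < d"
  shows "\<theta> powr m * f x \<le> f (\<theta> * x)" "f (\<theta> * x) \<le> \<theta> powr M * f x"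
proof -
  have *: "0 < x" "x \<le> \<theta> * x" "\<theta> * x < d" using assms by (auto simp: mult_le_cancel_right1)
  show "\<theta> powr m * f x \<le> f (\<theta> * x)" "f (\<theta> * x) \<le> \<theta> powr M * f x"
    using power_growth[OF *] assms by simp_all
qed

lemma eventually_scale_in_domain:
  "c > 0 \<Longrightarrow> eventually (\<lambda>x. 0 < x \<and> x < d \<and> 0 < c * x \<and> c * x < d) (at_right 0)"
  by (rule eventually_at_rightI[of 0 "min d (d / c)"]) (use d in \<open>auto simp: field_simps\<close>)

text \<open>If \<open>f \<le> C v\<close>, then \<open>v x \<ge> f (\<theta> x)\<close> for the \<open>\<theta>\<close> with \<open>\<theta>\<^bsup>m\<^esup> = 1 / C\<close>, and \<open>N\<close> is monotone. The
two lemmas after this one use the same device. The constant is enlarged to at least \<open>1\<close>, so that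
\<open>\<theta> \<le> 1\<close> and \<open>\<theta> x\<close> stays in the domain.\<close>

lemma content_lower_bound:
  assumes "C > 0" "eventually (\<lambda>x. f x \<le> C * v x) (at_right 0)"
  shows "\<exists>A>0. eventually (\<lambda>x. A \<le> N (v x) / x) (at_right 0)"
proof (intro exI conjI)
  define \<theta> where "\<theta> = (1 / max C 1) powr (1 / m)"
  have \<theta>: "0 < \<theta>" "\<theta> \<le> 1" "\<theta> powr m = 1 / max C 1"
    using m by (auto simp: \<theta>_def powr_powr intro!: powr_le1)
  show "A\<^sub>0 * \<theta> > 0" using A0 \<theta> by simp
  show "eventually (\<lambda>x. A\<^sub>0 * \<theta> \<le> N (v x) / x) (at_right 0)"
    using assms(2) eventually_scale_in_domain[OF \<theta>(1)] eventually_at_right_0_scale[OF N_at_f \<theta>(1)]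
  proof eventually_elim
    case (elim x)
    have "f (\<theta> * x) \<le> f x / max C 1" using power_growth_contract(2)[OF \<theta>(1,2), of x] elim \<theta>(3) by simp
    also have "\<dots> \<le> f x / C" using pos[of x] elim assms(1) by (intro divide_left_mono) auto
    also have "\<dots> \<le> v x" using elim assms(1) by (simp add: field_simps)
    finally have "N (f (\<theta> * x)) \<le> N (v x)" by (rule N_mono)
    then show ?case using elim by (simp add: field_simps)
  qed
qed

lemma content_upper_bound:
  assumes "C > 0" "eventually (\<lambda>x. v x \<le> C * f x) (at_right 0)"
  shows "\<exists>B>0. eventually (\<lambda>x. N (v x) / x \<le> B) (at_right 0)"
proof (intro exI conjI)
  define \<theta> where "\<theta> = max C 1 powr (1 / m)"
  have \<theta>: "1 \<le> \<theta>" "\<theta> powr m = max C 1"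
    using m by (auto simp: \<theta>_def powr_powr intro!: ge_one_powr_ge_zero)
  then have \<theta>0: "\<theta> > 0" by simp
  show "B\<^sub>0 * \<theta> > 0" using B0 \<theta> by simp
  show "eventually (\<lambda>x. N (v x) / x \<le> B\<^sub>0 * \<theta>) (at_right 0)"
    using assms(2) eventually_scale_in_domain[OF \<theta>0] eventually_at_right_0_scale[OF N_at_f \<theta>0]
  proof eventually_elim
    case (elim x)
    have "v x \<le> C * f x" using elim by simp
    also have "\<dots> \<le> max C 1 * f x" using pos[of x] elim by (intro mult_right_mono) auto
    also have "\<dots> \<le> f (\<theta> * x)" using power_growth_dilate(1)[OF \<theta>(1), of x] elim \<theta>(2) by simp
    finally have "N (v x) \<le> N (f (\<theta> * x))" by (rule N_mono)
    then show ?case using elim by (simp add: field_simps)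
  qed
qed

lemma content_negligible:
  assumes "((\<lambda>x. v x / f x) \<longlongrightarrow> 0) (at_right 0)"
  shows "((\<lambda>x. N (v x) / x) \<longlongrightarrow> 0) (at_right 0)"
  unfolding tendsto_iff
proof (intro allI impI)
  fix r :: real assume r: "r > 0"
  define \<theta> where "\<theta> = min 1 (r / (2 * B\<^sub>0))"
  have \<theta>: "0 < \<theta>" "\<theta> \<le> 1" "B\<^sub>0 * \<theta> < r"
    using r B0 by (auto simp: \<theta>_def min_def field_simps)
  have "eventually (\<lambda>x. v x / f x < \<theta> powr M) (at_right 0)"
    using order_tendstoD(2)[OF assms] \<theta> by simp
  then show "eventually (\<lambda>x. dist (N (v x) / x) 0 < r) (at_right 0)"
    using eventually_scale_in_domain[OF \<theta>(1)] eventually_at_right_0_scale[OF N_at_f \<theta>(1)]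
  proof eventually_elim
    case (elim x)
    have "v x \<le> \<theta> powr M * f x" using elim pos[of x] by (simp add: field_simps)
    also have "\<dots> \<le> f (\<theta> * x)" using power_growth_contract(1)[OF \<theta>(1,2), of x] elim by simp
    finally have "N (v x) \<le> N (f (\<theta> * x))" by (rule N_mono)
    then have "N (v x) / x \<le> B\<^sub>0 * \<theta>" using elim by (simp add: field_simps)
    then show ?case using \<theta>(3) N_nonneg[of "v x"] elim by (simp add: dist_real_def)
  qed
qed

text \<open>For the converse, \<open>N (v x)\<close> is compared with \<open>N (f (K x))\<close> and \<open>N (f (\<theta> x))\<close>: if it is strictly
between them, then \<open>v x\<close> is between \<open>f (\<theta> x)\<close> and \<open>f (K x)\<close>, because \<open>N\<close> is monotone.\<close>

lemma comparable_iff_content_comparable: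
  assumes v: "\<And>x. x \<in> {0<..<d} \<Longrightarrow> v x > 0"
  shows "comparable_at_0 f v \<longleftrightarrow>
    (\<exists>A>0. \<exists>B>0. eventually (\<lambda>x. A \<le> N (v x) / x \<and> N (v x) / x \<le> B) (at_right 0))"
proof
  assume "comparable_at_0 f v"
  then obtain A B where AB: "A > 0" "B > 0"
      "eventually (\<lambda>x. A \<le> f x / v x \<and> f x / v x \<le> B) (at_right 0)"
    by (auto simp: comparable_at_0_iff_eventually)
  have "eventually (\<lambda>x. x \<in> {0<..<d}) (at_right 0)" using d eventually_at_rightI[of 0 d] by auto
  then have "eventually (\<lambda>x. f x \<le> B * v x) (at_right 0)" "eventually (\<lambda>x. v x \<le> (1 / A) * f x) (at_right 0)"
    using AB(3) by (eventually_elim, use v AB in \<open>auto simp: field_simps\<close>)+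
  then obtain A' B' where "A' > 0" "eventually (\<lambda>x. A' \<le> N (v x) / x) (at_right 0)"
    "B' > 0" "eventually (\<lambda>x. N (v x) / x \<le> B') (at_right 0)"
    using content_lower_bound[OF AB(2), of v] content_upper_bound[of "1 / A" v] AB(1) by auto
  then show "\<exists>A>0. \<exists>B>0. eventually (\<lambda>x. A \<le> N (v x) / x \<and> N (v x) / x \<le> B) (at_right 0)"
    using eventually_conj by blast
next
  assume "\<exists>A>0. \<exists>B>0. eventually (\<lambda>x. A \<le> N (v x) / x \<and> N (v x) / x \<le> B) (at_right 0)"
  then obtain A B where AB: "A > 0" "B > 0"
      "eventually (\<lambda>x. A \<le> N (v x) / x \<and> N (v x) / x \<le> B) (at_right 0)" by blast
  define K where "K = max 1 (2 * B / A\<^sub>0)"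
  have K: "1 \<le> K" "K > 0" "B < A\<^sub>0 * K" using A0 AB by (auto simp: K_def max_def field_simps)
  define \<theta> where "\<theta> = min 1 (A / (2 * B\<^sub>0))"
  have \<theta>: "0 < \<theta>" "\<theta> \<le> 1" "B\<^sub>0 * \<theta> < A" using AB B0 by (auto simp: \<theta>_def min_def field_simps)
  have "eventually (\<lambda>x. 1 / K powr M \<le> f x / v x \<and> f x / v x \<le> 1 / \<theta> powr M) (at_right 0)"
    using AB(3) eventually_scale_in_domain[OF K(2)] eventually_at_right_0_scale[OF N_at_f K(2)]
      eventually_scale_in_domain[OF \<theta>(1)] eventually_at_right_0_scale[OF N_at_f \<theta>(1)]
  proof eventually_elim
    case (elim x)
    have x: "x > 0" "v x > 0" using elim v by auto
    have "N (v x) < N (f (K * x))"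
    proof -
      have "N (v x) \<le> B * x" using elim x by (simp add: field_simps)
      also have "\<dots> < A\<^sub>0 * K * x" using K x by simp
      also have "\<dots> \<le> N (f (K * x))" using elim by (simp add: mult.assoc)
      finally show ?thesis .
    qed
    then have "v x < f (K * x)" using N_mono[of "f (K * x)" "v x"] by linarith
    also have "\<dots> \<le> K powr M * f x" using power_growth_dilate(2)[OF K(1), of x] elim by simp
    finally have 1: "v x \<le> K powr M * f x" by simp
    have "N (f (\<theta> * x)) < N (v x)"
    proof -
      have "N (f (\<theta> * x)) \<le> B\<^sub>0 * \<theta> * x" using elim by (simp add: mult.assoc)
      also have "\<dots> < A * x" using \<theta> x by simp
      also have "\<dots> \<le> N (v x)" using elim x by (simp add: field_simps)
      finally show ?thesis .
    qed
    then have "f (\<theta> * x) < v x" using N_mono[of "v x" "f (\<theta> * x)"] by linarith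
    then have 2: "\<theta> powr M * f x \<le> v x" using power_growth_contract(1)[OF \<theta>(1,2), of x] elim by simp
    show ?case using 1 2 x K \<theta> by (simp add: field_simps)
  qed
  moreover have "1 / K powr M > 0" "1 / \<theta> powr M > 0" using K \<theta> by auto
  ultimately show "comparable_at_0 f v" unfolding comparable_at_0_iff_eventually by blast
qed

end

section \<open>Bounding the multiplicity with Rolle's theorem\<close>

text \<open>The zeros of \<open>h'\<close> are located below \<open>Max Z\<close> to make the induction work: the zero that is found between
the two largest elements of \<open>Z\<close> is then different from those found earlier.\<close>

lemma rolle_zeros:
  fixes h :: "real \<Rightarrow> real"
  assumes deriv: "\<And>x. x \<in> {0<..<b} \<Longrightarrow> (h has_real_derivative h' x) (at x)"
    and "card Z = Suc n" "Z \<subseteq> {0<..<b}" "\<And>z. z \<in> Z \<Longrightarrow> h z = 0"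
  shows "\<exists>Z'. finite Z' \<and> card Z' = n \<and> Z' \<subseteq> {0<..<Max Z} \<and> (\<forall>z\<in>Z'. h' z = 0)"
  using assms(2-)
proof (induction n arbitrary: Z)
  case 0
  then show ?case by (intro exI[of _ "{}"]) auto
next
  case (Suc n)
  have fin: "finite Z" using Suc.prems(1) card.infinite by fastforce
  have ne: "Z \<noteq> {}" using Suc.prems(1) by auto
  define Y where "Y = Z - {Max Z}"
  have Max: "Max Z \<in> Z" using fin ne by simp
  have cardY: "card Y = Suc n" using Suc.prems(1) fin Max by (simp add: Y_def)
  have finY: "finite Y" "Y \<noteq> {}" using cardY card.infinite[of Y] by force+
  have MaxY: "Max Y \<in> Y" using finY by simp
  then have less: "Max Y < Max Z" using fin by (auto simp: Y_def order_neq_le_trans)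
  obtain Z' where Z': "card Z' = n" "Z' \<subseteq> {0<..<Max Y}" "\<forall>z\<in>Z'. h' z = 0" "finite Z'"
    using Suc.IH[OF cardY] Suc.prems by (auto simp: Y_def)
  have in_b: "x \<in> {0<..<b}" if "Max Y \<le> x" "x \<le> Max Z" for x
    using that MaxY Max Suc.prems(2) by (auto simp: Y_def)
  have "\<exists>z. Max Y < z \<and> z < Max Z \<and> (*) (h' z) = (\<lambda>v. 0)"
  proof (rule Rolle_deriv[OF less, where f' = "\<lambda>z. (*) (h' z)"])
    show "h (Max Y) = h (Max Z)" using MaxY Max Suc.prems(3) by (simp add: Y_def)
    show "continuous_on {Max Y..Max Z} h"
      by (intro continuous_at_imp_continuous_on ballI DERIV_isCont[OF deriv[OF in_b]]) auto
    show "(h has_derivative (*) (h' x)) (at x)" if "Max Y < x" "x < Max Z" for x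
      using deriv[OF in_b] that by (simp add: has_field_derivative_def)
  qed
  then obtain z where z: "Max Y < z" "z < Max Z" and "(*) (h' z) = (\<lambda>v. 0)" by blast
  from fun_cong[OF this(3), of 1] have z0: "h' z = 0" by simp
  have "z \<notin> Z'" using z Z'(2) by auto
  moreover note Z'(4)
  ultimately have "card (insert z Z') = Suc n" using Z' by simp
  moreover have "insert z Z' \<subseteq> {0<..<Max Z}"
    using Z'(2) z less MaxY Suc.prems(2) by (auto simp: Y_def)
  ultimately show ?case using Z'(3,4) z0 by (intro exI[of _ "insert z Z'"]) auto
qed

context
  fixes d :: real and r :: enat and l :: nat and u :: "nat \<Rightarrow> real \<Rightarrow> real"
  assumes d: "d > 0" and cheb: "chebyshev_scale d r l u"
begin

text \<open>Each passage from \<open>D\<^sub>j h\<close> to \<open>D\<^sub>j\<^sub>+\<^sub>1 h\<close> loses at most one zero: dividing by the positive weight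
does not change the zeros of \<open>(D\<^sub>j h)'\<close>.\<close>

lemma gderiv_zeros:
  assumes h: "gderivs_defined d l u h" and k: "k \<le> l" and b: "b \<le> d"
    and Z: "finite Z" "card Z = Suc k" "Z \<subseteq> {0<..<b}" "\<And>z. z \<in> Z \<Longrightarrow> h z = 0"
  shows "\<exists>z\<in>{0<..<b}. gderiv u k h z = 0"
proof -
  have "\<exists>Y. finite Y \<and> card Y = Suc (k - j) \<and> Y \<subseteq> {0<..<b} \<and> (\<forall>z\<in>Y. gderiv u j h z = 0)"
    if "j \<le> k" for j
    using that
  proof (induction j)
    case 0
    then show ?case using Z by (intro exI[of _ Z]) auto
  next
    case (Suc j)
    then obtain Y where Y: "finite Y" "card Y = Suc (Suc (k - Suc j))" "Y \<subseteq> {0<..<b}"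
      "\<And>z. z \<in> Y \<Longrightarrow> gderiv u j h z = 0"
      using Suc_diff_Suc[of j k] by force
    have "\<exists>Y'. finite Y' \<and> card Y' = Suc (k - Suc j) \<and> Y' \<subseteq> {0<..<Max Y} \<and>
            (\<forall>z\<in>Y'. deriv (gderiv u j h) z = 0)"
    proof (rule rolle_zeros[where b = b and h = "gderiv u j h"])
      show "(gderiv u j h has_real_derivative deriv (gderiv u j h) x) (at x)" if "x \<in> {0<..<b}" for x
        using gderivs_defined_has_deriv[OF h, of j x] that Suc.prems k b by auto
    qed (use Y in auto)
    then obtain Y' where Y': "finite Y'" "card Y' = Suc (k - Suc j)" "Y' \<subseteq> {0<..<Max Y}"
      "\<forall>z\<in>Y'. deriv (gderiv u j h) z = 0" by blast
    have "Max Y \<in> Y" using Y by (intro Max_in) auto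
    then have "Y' \<subseteq> {0<..<b}" using Y' Y(3) by force
    then show ?case using Y' by (intro exI[of _ Y']) auto
  qed
  from this[of k] obtain Y where "card Y = Suc 0" "Y \<subseteq> {0<..<b}" "\<forall>z\<in>Y. gderiv u k h z = 0"
    by auto
  moreover from this obtain z where "z \<in> Y" by (metis card.empty equals0I nat.distinct(1))
  ultimately show ?thesis by blast
qed

end

text \<open>With more than \<open>k\<close> zeros of \<open>f\<^sub>\<lambda>\<close> near \<open>0\<close>, the function \<open>D\<^sub>k f\<^sub>\<lambda>\<close> would have a zero near \<open>0\<close>. But
\<open>D\<^sub>k f\<^sub>\<lambda>\<close> is close to its limit \<open>\<alpha>\<^sub>k(\<lambda>)\<close> there, uniformly in \<open>\<lambda>\<close>, and \<open>\<alpha>\<^sub>k(\<lambda>)\<close> is close to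
\<open>\<alpha>\<^sub>k(\<lambda>\<^sub>0) \<noteq> 0\<close>.\<close>

lemma zero_mult_bound:
  fixes T :: "'l topology"
  assumes d: "d > 0"
    and scales: "\<And>lam. lam \<in> topspace T \<Longrightarrow> chebyshev_scale d r l (u lam)"
    and dev: "uniform_development T d l u f \<alpha> \<psi>"
    and k: "k \<le> l" and nonzero: "\<alpha> k lam0 \<noteq> 0"
    and mult: "zero_mult_ge T d f lam0 p"
  shows "p \<le> k"
proof (rule ccontr)
  assume "\<not> p \<le> k"
  then have p: "{1..Suc k} \<subseteq> {1..p}" by auto
  obtain s y where s: "\<And>n. s n \<in> topspace T" "limitin T s lam0 sequentially"
    and inj: "\<And>n. inj_on (y n) {1..p}"
    and y: "\<And>n j. j \<in> {1..p} \<Longrightarrow> y n j \<in> {0..<d} \<and> y n j \<noteq> 0 \<and> f (s n) (y n j) = 0"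
    and y0: "\<And>j. j \<in> {1..p} \<Longrightarrow> (\<lambda>n::nat. y n j) \<longlonglongrightarrow> 0"
    using mult unfolding zero_mult_ge_def by blast
  have hd: "has_development d l (u lam) (f lam) (\<lambda>i. \<alpha> i lam) (\<psi> lam)" if "lam \<in> topspace T" for lam
    using dev that by (simp add: uniform_development_def)
  have at0: "gderiv0 (u lam) k (f lam) 0 = \<alpha> k lam" if "lam \<in> topspace T" for lam
    using gderiv0_at_0_development[OF d scales[OF that] hd[OF that] k] .
  have lam0: "lam0 \<in> topspace T" using s(2) by (simp add: limitin_topspace)
  have "continuous_map T euclideanreal (\<lambda>lam. gderiv0 (u lam) k (f lam) 0)"
    using dev k d by (simp add: uniform_development_def)
  then have "limitin euclideanreal ((\<lambda>lam. gderiv0 (u lam) k (f lam) 0) \<circ> s)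
      (gderiv0 (u lam0) k (f lam0) 0) sequentially"
    using s(2) by (rule continuous_map_limit)
  then have lim: "(\<lambda>n. \<alpha> k (s n)) \<longlonglongrightarrow> \<alpha> k lam0"
    using at0 s(1) lam0 by (simp add: o_def)
  define e where "e = \<bar>\<alpha> k lam0\<bar> / 2"
  have e: "e > 0" using nonzero by (simp add: e_def)
  have "uniform_limit (topspace T) (\<lambda>x lam. gderiv (u lam) k (f lam) x)
      (\<lambda>lam. gderiv0 (u lam) k (f lam) 0) (at_right 0)"
    using dev k by (simp add: uniform_development_def)
  from uniform_limitD[OF this e] obtain b where b: "b > 0"
    "\<And>x lam. 0 < x \<Longrightarrow> x < b \<Longrightarrow> lam \<in> topspace T \<Longrightarrow>
       dist (gderiv (u lam) k (f lam) x) (gderiv0 (u lam) k (f lam) 0) < e"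
    by (auto simp: eventually_at_right_field)
  have "eventually (\<lambda>n. dist (\<alpha> k (s n)) (\<alpha> k lam0) < e) sequentially"
    using lim e by (rule tendstoD)
  moreover have "eventually (\<lambda>n. \<forall>j\<in>{1..Suc k}. y n j < min b d) sequentially"
    using y0 p b(1) d by (intro eventually_ball_finite ballI order_tendstoD(2)) auto
  ultimately have "eventually (\<lambda>n. dist (\<alpha> k (s n)) (\<alpha> k lam0) < e \<and>
      (\<forall>j\<in>{1..Suc k}. y n j < min b d)) sequentially"
    by (rule eventually_conj)
  from eventually_happens'[OF sequentially_bot this]
  obtain n where n: "dist (\<alpha> k (s n)) (\<alpha> k lam0) < e"
    "\<And>j. j \<in> {1..Suc k} \<Longrightarrow> y n j < min b d" by blast
  have "\<exists>z\<in>{0<..<min b d}. gderiv (u (s n)) k (f (s n)) z = 0"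
  proof (rule gderiv_zeros[OF d scales[OF s(1)] development_gderivs(2)[OF d scales[OF s(1)] hd[OF s(1)]] k])
    show "card (y n ` {1..Suc k}) = Suc k"
      using card_image[OF inj_on_subset[OF inj p]] by simp
    show "y n ` {1..Suc k} \<subseteq> {0<..<min b d}"
    proof
      fix z assume "z \<in> y n ` {1..Suc k}"
      then obtain j where j: "j \<in> {1..Suc k}" "z = y n j" by auto
      have "y n j \<ge> 0 \<and> y n j \<noteq> 0" using y[of j n] j p by auto
      then show "z \<in> {0<..<min b d}" using n(2)[OF j(1)] j(2) by auto
    qed
    show "f (s n) z = 0" if "z \<in> y n ` {1..Suc k}" for z using y p that by blast
  qed auto
  then obtain z where "0 < z" "z < b" "gderiv (u (s n)) k (f (s n)) z = 0" by auto
  then have "\<bar>\<alpha> k (s n)\<bar> < e" using b(2)[OF _ _ s(1)[of n], of z] at0[OF s(1)] by (simp add: dist_real_def)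
  then show False using n(1) by (simp add: e_def dist_real_def abs_if split: if_splits)
qed

section \<open>Prescribing the coefficients by regular parameters\<close>

(* The symbol $ denotes the components of vectors in Euclidean space below, as opposed to the
   entries of list-like vectors that come with matrices of variable size. *)
no_notation Matrix.vec_index (infixl "$" 100)

lemma partial_deriv_eq_frechet:
  assumes "a differentiable (at q)"
  shows "partial_deriv a j q = frechet_derivative a (at q) (axis j 1)"
proof -
  have "(a has_derivative frechet_derivative a (at q)) (at (q + 0 *\<^sub>R axis j 1))"
    using assms frechet_derivative_works by auto
  moreover have "((\<lambda>t. q + t *\<^sub>R axis j 1) has_derivative (\<lambda>t. t *\<^sub>R axis j 1)) (at 0)"
    by (auto intro!: derivative_eq_intros)
  ultimately have "((\<lambda>t. a (q + t *\<^sub>R axis j 1)) has_derivative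
      (\<lambda>t. frechet_derivative a (at q) (t *\<^sub>R axis j 1))) (at 0)"
    using has_derivative_compose by blast
  moreover have "linear (frechet_derivative a (at q))"
    using assms linear_frechet_derivative by blast
  ultimately have "((\<lambda>t. a (q + t *\<^sub>R axis j 1)) has_real_derivative
      frechet_derivative a (at q) (axis j 1)) (at 0)"
    by (simp add: has_field_derivative_def linear_cmul mult_commute_abs)
  then show ?thesis by (simp add: partial_deriv_def DERIV_imp_deriv)
qed

lemma has_derivative_vec_lambda:
  fixes F :: "'a::real_normed_vector \<Rightarrow> real ^ 'n"
  assumes "\<And>j. ((\<lambda>x. F x $ j) has_derivative (\<lambda>x. F' x $ j)) (at q)"
  shows "(F has_derivative F') (at q)"
  using assms
  by (subst has_derivative_componentwise_within)
    (auto simp: Basis_vec_def inner_axis)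

lemma linear_eq_sum_axis:
  fixes L :: "real ^ 'n \<Rightarrow> real"
  assumes "linear L"
  shows "L h = (\<Sum>j\<in>UNIV. h $ j * L (axis j 1))"
proof -
  have "L h = L (\<Sum>j\<in>UNIV. h $ j *\<^sub>R axis j 1)"
    using basis_expansion[of h] by (simp add: scalar_mult_eq_scaleR)
  also have "\<dots> = (\<Sum>j\<in>UNIV. h $ j * L (axis j 1))"
    using assms by (simp add: linear_sum linear_cmul)
  finally show ?thesis .
qed

text \<open>Passes from the matrix type, in which the rank is defined, to plain sums over indices.\<close>

lemma full_rank_mat_kernel:
  fixes P :: "nat \<Rightarrow> nat \<Rightarrow> 'a::field"
  assumes "vec_space.rank p (Matrix.mat p p (\<lambda>(i, j). P i j)) = p"
    and "\<And>i. i < p \<Longrightarrow> (\<Sum>j<p. P i j * x j) = 0" and "j < p"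
  shows "x j = 0"
proof -
  define A where "A = Matrix.mat p p (\<lambda>(i, j). P i j)"
  define v where "v = Matrix.vec p x"
  have A: "A \<in> carrier_mat p p" by (simp add: A_def)
  have "Determinant.det A \<noteq> 0" using vec_space.det_rank_iff[OF A] assms(1) by (simp add: A_def)
  moreover have "A *\<^sub>v v = 0\<^sub>v p"
  proof (rule eq_vecI)
    fix i assume i: "i < dim_vec (0\<^sub>v p :: 'a Matrix.vec)"
    then show "vec_index (A *\<^sub>v v) i = vec_index (0\<^sub>v p) i"
      using assms(2)[of i]
      by (simp add: A_def v_def scalar_prod_def atLeast0LessThan)
  qed (simp add: A_def)
  moreover have "v \<in> carrier_vec p" by (simp add: v_def)
  ultimately have "v = 0\<^sub>v p" using det_0_iff_vec_prod_zero[OF A] by blast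
  then have "vec_index v j = 0" using assms(3) by simp
  then show ?thesis using assms(3) by (simp add: v_def)
qed

text \<open>Near \<open>lam0\<close> the first \<open>p\<close> coefficients may be prescribed freely: \<open>\<sigma>\<close> is a continuous choice of
parameters that has the coordinates \<open>e 1, \<dots>, e p\<close> of its argument as coefficients. It comes
from the inverse function theorem. That theorem needs spaces of equal dimension; so the coordinates beyond
the first \<open>p\<close> are kept as they are, which makes the derivative block triangular, with the given
matrix of rank \<open>p\<close> as the only nontrivial block.\<close>

lemma regular_params_section:
  fixes T :: "'l topology" and c :: "'l \<Rightarrow> real ^ 'n" and e :: "nat \<Rightarrow> 'n"
  assumes reg: "regular_params T c e \<alpha> lam0 p" and p: "0 < p" and lam0: "lam0 \<in> topspace T"
  shows "\<exists>V w0 \<sigma>. open V \<and> w0 \<in> V \<and> continuous_map (top_of_set V) T \<sigma> \<and> \<sigma> w0 = lam0 \<and>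
           (\<forall>w\<in>V. \<forall>i<p. \<alpha> i (\<sigma> w) = w $ e (Suc i))"
proof -
  define a where "a i q = \<alpha> i (inv_into (topspace T) c q)" for i q
  define q0 where "q0 = c lam0"
  have emb: "embedding_map T euclidean c" and e: "bij_betw e {1..CARD('n)} UNIV"
    and pN: "p \<le> CARD('n)" and C1: "\<And>i. i < p \<Longrightarrow> C1_near (c ` topspace T) (a i) q0"
    and rank: "vec_space.rank p (Matrix.mat p p (\<lambda>(i, j). partial_deriv (a i) (e (Suc j)) q0)) = p"
    using reg by (auto simp: regular_params_def a_def[abs_def] q0_def)
  obtain W where W: "\<And>i. i < p \<Longrightarrow> open (W i) \<and> q0 \<in> W i \<and> W i \<subseteq> c ` topspace T \<and>
      (\<forall>q\<in>W i. a i differentiable (at q)) \<and> (\<forall>j. continuous_on (W i) (partial_deriv (a i) j))"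
    using C1 unfolding C1_near_def by metis
  define U where "U = (\<Inter>i<p. W i)"
  have "open U" "q0 \<in> U" using W by (auto simp: U_def intro!: open_INT)
  moreover have "U \<subseteq> W 0" using p by (auto simp: U_def)
  ultimately have U: "open U" "q0 \<in> U" "U \<subseteq> c ` topspace T" using W[OF p] by auto
  have diff: "a i differentiable (at q)" if "i < p" "q \<in> U" for i q
    using W that by (auto simp: U_def)
  have cont: "continuous_on U (partial_deriv (a i) j)" if "i < p" for i j
    using W[OF that] that by (auto simp: U_def intro: continuous_on_subset)
  \<comment> \<open>The matrix is numbered from \<open>0\<close>, the coordinates from \<open>1\<close>: a coordinate \<open>j\<close>
    among the first \<open>p\<close> belongs to the coefficient \<open>num j - 1\<close>.\<close>
  define num where "num = inv_into {1..CARD('n)} e"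
  have num: "num j \<in> {1..CARD('n)}" "e (num j) = j" for j
    using e bij_betw_inv_into[OF e] unfolding num_def
    by (auto simp: bij_betw_def f_inv_into_f intro: inv_into_into)
  have num_e: "num (e i) = i" if "i \<in> {1..CARD('n)}" for i
    using e that by (simp add: num_def bij_betw_def)
  define F where "F q = (\<chi> j. if num j \<le> p then a (num j - 1) q else q $ j)" for q
  define F' where "F' q h = (\<chi> j. if num j \<le> p then frechet_derivative (a (num j - 1)) (at q) h
      else h $ j)" for q h :: "real ^ 'n"
  have derF: "(F has_derivative F' q) (at q)" if "q \<in> U" for q
  proof (rule has_derivative_vec_lambda)
    fix j
    show "((\<lambda>q. F q $ j) has_derivative (\<lambda>h. F' q h $ j)) (at q)"
    proof (cases "num j \<le> p")
      case True
      then have "num j - 1 < p" using num(1)[of j] by auto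
      then show ?thesis using diff that True frechet_derivative_works by (auto simp: F_def F'_def)
    next
      case False
      then show ?thesis by (simp add: F_def F'_def bounded_linear_imp_has_derivative bounded_linear_vec_nth)
    qed
  qed
  define B where "B q = Blinfun (F' q)" for q
  have B: "blinfun_apply (B q) = F' q" if "q \<in> U" for q
    using has_derivative_bounded_linear[OF derF[OF that]] by (simp add: B_def bounded_linear_Blinfun_apply)
  have contB: "continuous_on U B"
  proof (rule continuous_on_blinfun_componentwise)
    fix b :: "real ^ 'n" assume "b \<in> Basis"
    then obtain k where k: "b = axis k 1" by (auto simp: Basis_vec_def)
    have "continuous_on U (\<lambda>q. \<chi> j. if num j \<le> p then partial_deriv (a (num j - 1)) k q
        else axis k 1 $ j)"
    proof (rule continuous_on_vec_lambda)
      fix j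
      show "continuous_on U (\<lambda>q. if num j \<le> p then partial_deriv (a (num j - 1)) k q else axis k 1 $ j)"
        using cont[of "num j - 1" k] num(1)[of j] by (cases "num j \<le> p") auto
    qed
    moreover have "B q b = (\<chi> j. if num j \<le> p then partial_deriv (a (num j - 1)) k q
        else axis k 1 $ j)" if "q \<in> U" for q
    proof -
      have "num j - 1 < p" if "num j \<le> p" for j using that num(1)[of j] by auto
      then show ?thesis
        unfolding k B[OF that] using diff[OF _ that]
        by (auto simp: F'_def Finite_Cartesian_Product.vec_eq_iff partial_deriv_eq_frechet)
    qed
    ultimately show "continuous_on U (\<lambda>q. B q b)" by (simp cong: continuous_on_cong)
  qed
  have lin: "linear (F' q0)"
    using has_derivative_bounded_linear[OF derF[OF U(2)]] bounded_linear.linear by blast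
  have "inj (F' q0)"
  proof (subst linear_injective_0[OF lin], intro allI impI)
    fix h :: "real ^ 'n" assume h: "F' q0 h = 0"
    have high: "h $ e i = 0" if "p < i" "i \<le> CARD('n)" for i
      using arg_cong[OF h, of "\<lambda>z. z $ e i"] that num_e[of i] by (simp add: F'_def)
    have "(\<Sum>j<p. partial_deriv (a i) (e (Suc j)) q0 * h $ e (Suc j)) = 0" if i: "i < p" for i
    proof -
      have "0 = frechet_derivative (a i) (at q0) h"
        using arg_cong[OF h, of "\<lambda>z. z $ e (Suc i)"] i pN num_e[of "Suc i"] by (simp add: F'_def)
      also have "\<dots> = (\<Sum>j\<in>UNIV. h $ j * partial_deriv (a i) j q0)"
        using linear_eq_sum_axis[OF linear_frechet_derivative[OF diff[OF i U(2)]], of h]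
          partial_deriv_eq_frechet[OF diff[OF i U(2)]] by simp
      also have "\<dots> = (\<Sum>j\<in>{1..CARD('n)}. h $ e j * partial_deriv (a i) (e j) q0)"
        by (rule sum.reindex_bij_betw[OF e, symmetric])
      also have "\<dots> = (\<Sum>j\<in>{1..p}. h $ e j * partial_deriv (a i) (e j) q0)"
        using pN high by (intro sum.mono_neutral_right) auto
      also have "\<dots> = (\<Sum>j<p. h $ e (Suc j) * partial_deriv (a i) (e (Suc j)) q0)"
        by (rule sum.reindex_bij_witness[of _ Suc "\<lambda>j. j - 1"]) auto
      finally show ?thesis by (simp add: mult.commute)
    qed
    then have low: "h $ e (Suc j) = 0" if "j < p" for j
      using full_rank_mat_kernel[OF rank, of "\<lambda>j. h $ e (Suc j)" j] that by auto
    have "h $ j = 0" for j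
      using high[of "num j"] low[of "num j - 1"] num[of j] by (cases "p < num j") auto
    then show "h = 0" by (simp add: Finite_Cartesian_Product.vec_eq_iff)
  qed
  then obtain G where G: "linear G" "G \<circ> F' q0 = id"
    using linear_injective_left_inverse[OF lin] by blast
  have "Blinfun G o\<^sub>L B q0 = id_blinfun"
    using G B[OF U(2)]
    by (intro blinfun_eqI) (simp add: bounded_linear_Blinfun_apply linear_conv_bounded_linear fun_eq_iff)
  then obtain U' V g g' where "open U'" and U': "U' \<subseteq> U" "q0 \<in> U'" and V: "open V" "F q0 \<in> V"
    and hom: "homeomorphism U' V F g"
    using inverse_function_theorem[of U F B q0 "Blinfun G"] U derF B contB by (metis (no_types, lifting))
  have "homeomorphic_map T (top_of_set (c ` topspace T)) c" using emb by (simp add: embedding_map_def)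
  then obtain c' where c': "homeomorphic_maps T (top_of_set (c ` topspace T)) c c'"
    by (auto simp: homeomorphic_map_maps)
  then have cont_c': "continuous_map (top_of_set (c ` topspace T)) T c'"
    and c'_c: "\<And>lam. lam \<in> topspace T \<Longrightarrow> c' (c lam) = lam"
    and c_c': "\<And>q. q \<in> c ` topspace T \<Longrightarrow> c (c' q) = q"
    by (auto simp: homeomorphic_maps_def)
  have inj: "inj_on c (topspace T)" using c'_c by (metis inj_onI)
  have inv: "inv_into (topspace T) c q = c' q" if "q \<in> c ` topspace T" for q
    using that c'_c inj by auto
  have gV: "g w \<in> U'" "F (g w) = w" if "w \<in> V" for w
    using hom that by (auto simp: homeomorphism_def)
  have gU: "g (F q) = q" if "q \<in> U'" for q
    using hom that by (auto simp: homeomorphism_def)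
  have "continuous_map (top_of_set V) (top_of_set (c ` topspace T)) g"
    using hom gV U' U(3) by (auto simp: continuous_map_in_subtopology homeomorphism_def)
  then have "continuous_map (top_of_set V) T (c' \<circ> g)"
    using cont_c' by (rule continuous_map_compose)
  moreover have "(c' \<circ> g) (F q0) = lam0" using gU[OF U'(2)] c'_c[OF lam0] by (simp add: q0_def)
  moreover have "\<alpha> i ((c' \<circ> g) w) = w $ e (Suc i)" if w: "w \<in> V" and i: "i < p" for w i
  proof -
    have "w $ e (Suc i) = F (g w) $ e (Suc i)" using gV[OF w] by simp
    also have "\<dots> = a i (g w)" using i pN num_e[of "Suc i"] by (simp add: F_def)
    also have "\<dots> = \<alpha> i (c' (g w))" using inv[of "g w"] gV[OF w] U' U(3) by (auto simp: a_def)
    finally show ?thesis by simp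
  qed
  ultimately show ?thesis using V by blast
qed

section \<open>Creating zeros\<close>

text \<open>Near \<open>0\<close>, a function has the sign of its first nonzero coefficient. The conclusion is on
\<open>D\<^sub>0 h = h / u\<^sub>0\<close>, which has the same zeros as \<open>h\<close>, because this is the function that depends continuously
on the parameter, and because \<open>u\<^sub>0\<close> may be negative while \<open>u\<^sub>i / u\<^sub>0\<close> is positive.\<close>

lemma gderiv_0_sign_near_0:
  assumes d: "d > 0" and cheb: "chebyshev_scale d r l u" and dev: "has_development d l u h a \<psi>"
    and i: "i \<le> l" and zero: "\<And>j. j < i \<Longrightarrow> a j = 0" and sign: "s * a i > 0"
  shows "eventually (\<lambda>x. s * gderiv u 0 h x > 0) (at_right 0)"
proof -
  have "((\<lambda>x. h x / u i x) \<longlongrightarrow> a i) (at_right 0)"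
    by (rule development_quotient_tendsto[OF d cheb dev i zero])
  then have "((\<lambda>x. s * (h x / u i x)) \<longlongrightarrow> s * a i) (at_right 0)" by (intro tendsto_intros)
  then have "eventually (\<lambda>x. s * (h x / u i x) > 0) (at_right 0)" using sign by (rule order_tendstoD(1))
  moreover have "eventually (\<lambda>x. u i x / u 0 x > 0) (at_right 0)"
    using eventually_at_right_0I[OF d, of "\<lambda>x. u i x / u 0 x > 0"] gderiv_scale_pos[OF d cheb _ i, of 0] by simp
  ultimately show ?thesis
  proof eventually_elim
    case (elim x)
    then have "s * (h x / u i x) * (u i x / u 0 x) > 0" by (rule mult_pos_pos)
    moreover have "u i x \<noteq> 0" using elim by auto
    ultimately show ?case by simp
  qed
qed

lemma alternating_imp_zeros:
  fixes q :: "real \<Rightarrow> real" and x :: "nat \<Rightarrow> real"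
  assumes cont: "continuous_on {0<..<b} q"
    and dec: "\<And>i. i < p \<Longrightarrow> x (Suc i) < x i"
    and x: "\<And>i. i \<le> p \<Longrightarrow> x i \<in> {0<..<b}"
    and sign: "\<And>i. i \<le> p \<Longrightarrow> (- 1) ^ i * q (x i) > 0"
  shows "\<exists>y. inj_on y {1..p} \<and> (\<forall>j\<in>{1..p}. y j \<in> {0<..<b} \<and> q (y j) = 0)"
proof -
  have "\<exists>z. x (Suc i) < z \<and> z < x i \<and> q z = 0" if i: "i < p" for i
  proof -
    define s :: real where "s = (- 1) ^ i"
    have s: "s * q (x i) > 0" "s * q (x (Suc i)) < 0" "s \<noteq> 0"
      using sign[of i] sign[of "Suc i"] i by (auto simp: s_def)
    have "\<exists>z\<ge>x (Suc i). z \<le> x i \<and> s * q z = 0"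
    proof (rule IVT')
      have "{x (Suc i)..x i} \<subseteq> {0<..<b}" using x[of i] x[of "Suc i"] i by auto
      then show "continuous_on {x (Suc i)..x i} (\<lambda>z. s * q z)"
        by (intro continuous_intros continuous_on_subset[OF cont])
    qed (use s dec[OF i] in auto)
    then obtain z where z: "x (Suc i) \<le> z" "z \<le> x i" "q z = 0" using s(3) by auto
    then have "z \<noteq> x i" "z \<noteq> x (Suc i)" using s by auto
    then show ?thesis using z by force
  qed
  then obtain z where z: "\<And>i. i < p \<Longrightarrow> x (Suc i) < z i \<and> z i < x i \<and> q (z i) = 0" by metis
  have mono: "x k \<le> x i" if "i \<le> k" "k \<le> p" for i k
    using that
  proof (induction k rule: dec_induct)
    case (step k)
    then show ?case using dec[of k] by simp
  qed simp
  have less: "z k < z i" if "i < k" "k < p" for i k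
    using z[of i] z[of k] mono[of "Suc i" k] that by fastforce
  have "inj_on (\<lambda>j. z (j - 1)) {1..p}"
  proof (rule inj_onI)
    fix i j assume ij: "i \<in> {1..p}" "j \<in> {1..p}" "z (i - 1) = z (j - 1)"
    then have "i - 1 < p" "j - 1 < p" by auto
    then have "i - 1 = j - 1" using ij(3) less[of "i - 1" "j - 1"] less[of "j - 1" "i - 1"]
      by (cases "i - 1" "j - 1" rule: linorder_cases) auto
    then show "i = j" using ij by auto
  qed
  moreover have "z (j - 1) \<in> {0<..<b} \<and> q (z (j - 1)) = 0" if "j \<in> {1..p}" for j
  proof -
    have "j - 1 < p" "Suc (j - 1) = j" using that by auto
    then show ?thesis using z[of "j - 1"] x[of "j - 1"] x[of j] that by auto
  qed
  ultimately show ?thesis by (intro exI[of _ "\<lambda>j. z (j - 1)"]) auto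
qed

text \<open>Start from \<open>lam0\<close>, where \<open>D\<^sub>0 f\<close> is positive at some point near \<open>0\<close>, and switch on the coefficients
\<open>\<alpha>\<^sub>p\<^sub>-\<^sub>1, \<dots>, \<alpha>\<^sub>0\<close> one after the other, with alternating signs. Each new coefficient is the first
nonzero one, so it dictates the sign of \<open>D\<^sub>0 f\<close> at some new point closer to \<open>0\<close>; if it is small
enough, the signs at the points found before survive, because the value of \<open>D\<^sub>0 f\<close> at a fixed
point is continuous in the parameter. After \<open>p\<close> steps there are \<open>p\<close> sign changes.\<close>

lemma zero_mult_ge_if_regular:
  fixes T :: "'l topology" and c :: "'l \<Rightarrow> real ^ 'n" and e :: "nat \<Rightarrow> 'n"
  assumes d: "d > 0"
    and scales: "\<And>lam. lam \<in> topspace T \<Longrightarrow> chebyshev_scale d r l (u lam)"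
    and dev: "uniform_development T d l u f \<alpha> \<psi>"
    and lam0: "lam0 \<in> topspace T"
    and l: "0 < l" and p: "0 < p" "p \<le> Suc l"
    and reg: "regular_params T c e \<alpha> lam0 p"
    and zero: "\<And>i. i < p \<Longrightarrow> \<alpha> i lam0 = 0"
    and pos: "eventually (\<lambda>x. gderiv (u lam0) 0 (f lam0) x > 0) (at_right 0)"
  shows "zero_mult_ge T d f lam0 p"
proof -
  have hd: "has_development d l (u lam) (f lam) (\<lambda>i. \<alpha> i lam) (\<psi> lam)" if "lam \<in> topspace T" for lam
    using dev that by (simp add: uniform_development_def)
  obtain V w0 \<sigma> where V: "open V" "w0 \<in> V" and \<sigma>: "continuous_map (top_of_set V) T \<sigma>" "\<sigma> w0 = lam0"
    and \<alpha>\<sigma>: "\<And>w i. w \<in> V \<Longrightarrow> i < p \<Longrightarrow> \<alpha> i (\<sigma> w) = w $ e (Suc i)"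
    using regular_params_section[OF reg p(1) lam0] by blast
  have \<sigma>T: "\<sigma> w \<in> topspace T" if "w \<in> V" for w
    using \<sigma>(1) that by (auto simp: continuous_map_def)
  have e: "inj_on e {1..CARD('n)}" "p \<le> CARD('n)"
    using reg by (auto simp: regular_params_def bij_betw_def)
  define Q where "Q w x = gderiv (u (\<sigma> w)) 0 (f (\<sigma> w)) x" for w x
  have Qcont: "continuous_on V (\<lambda>w. Q w x)" if "x \<in> {0<..<d}" for x
  proof -
    have "continuous_map T euclideanreal (\<lambda>lam. gderiv0 (u lam) 0 (f lam) x)"
      using dev that by (auto simp: uniform_development_def)
    from continuous_map_compose[OF \<sigma>(1) this]
    show ?thesis using that by (simp add: o_def gderiv0_def Q_def[abs_def])
  qed
  have step: "\<exists>w x. w \<in> V \<and> dist w w0 < \<epsilon> \<and> (\<forall>i<p - j. w $ e (Suc i) = 0) \<and>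
        (\<forall>i<j. x (Suc i) < x i) \<and> (\<forall>i\<le>j. x i \<in> {0<..<\<delta>} \<and> (- 1) ^ i * Q w (x i) > 0)"
    if "j \<le> p" "0 < \<epsilon>" "0 < \<delta>" "\<delta> \<le> d" for j \<epsilon> \<delta>
    using that(1)
  proof (induction j)
    case 0
    have "eventually (\<lambda>x. Q w0 x > 0 \<and> x \<in> {0<..<\<delta>}) (at_right 0)"
      using pos eventually_at_right_0I[OF that(3), of "\<lambda>x. x \<in> {0<..<\<delta>}"]
      by (intro eventually_conj) (auto simp: Q_def \<sigma>(2))
    from eventually_happens'[OF _ this] obtain z where "Q w0 z > 0" "z \<in> {0<..<\<delta>}" by auto
    moreover have "w0 $ e (Suc i) = 0" if "i < p" for i
      using \<alpha>\<sigma>[OF V(2) that] zero[OF that] \<sigma>(2) by simp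
    ultimately show ?case using V(2) that(2) by (intro exI[of _ w0] exI[of _ "\<lambda>_. z"]) auto
  next
    case (Suc j)
    then obtain w x where w: "w \<in> V" "dist w w0 < \<epsilon>" "\<And>i. i < p - j \<Longrightarrow> w $ e (Suc i) = 0"
      and x: "\<And>i. i < j \<Longrightarrow> x (Suc i) < x i"
        "\<And>i. i \<le> j \<Longrightarrow> x i \<in> {0<..<\<delta>} \<and> (- 1) ^ i * Q w (x i) > 0"
      by auto
    define k where "k = p - Suc j"
    have k: "k < p" "k \<le> l" "p - j = Suc k" using Suc.prems p by (auto simp: k_def)
    \<comment> \<open>The path that switches on coefficient \<open>k\<close>, with the sign opposite to the last one.\<close>
    define \<rho> where "\<rho> t = w + (t * (- 1) ^ Suc j) *\<^sub>R axis (e (Suc k)) (1 :: real)" for t :: real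
    have \<rho>: "(\<rho> \<longlongrightarrow> w) (at_right 0)"
      unfolding \<rho>_def by (auto intro!: tendsto_eq_intros)
    have "eventually (\<lambda>t. \<rho> t \<in> V \<inter> ball w0 \<epsilon>) (at_right 0)"
      using V(1) w by (intro topological_tendstoD[OF \<rho>]) (auto simp: dist_commute)
    moreover have "eventually (\<lambda>t. \<forall>i\<in>{..j}. (- 1) ^ i * Q (\<rho> t) (x i) > 0) (at_right 0)"
    proof (intro eventually_ball_finite ballI)
      fix i assume i: "i \<in> {..j}"
      then have "x i \<in> {0<..<d}" using x(2)[of i] that(4) by auto
      then have "isCont (\<lambda>w. Q w (x i)) w"
        using Qcont V(1) w(1) continuous_on_eq_continuous_at by blast
      then have "((\<lambda>t. Q (\<rho> t) (x i)) \<longlongrightarrow> Q w (x i)) (at_right 0)"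
        using \<rho> by (rule isCont_tendsto_compose)
      then have "((\<lambda>t. (- 1) ^ i * Q (\<rho> t) (x i)) \<longlongrightarrow> (- 1) ^ i * Q w (x i)) (at_right 0)"
        by (intro tendsto_intros)
      then show "eventually (\<lambda>t. (- 1) ^ i * Q (\<rho> t) (x i) > 0) (at_right 0)"
        by (rule order_tendstoD(1)) (use x(2) i in auto)
    qed simp
    ultimately have "eventually (\<lambda>t. t > 0 \<and> \<rho> t \<in> V \<inter> ball w0 \<epsilon> \<and>
        (\<forall>i\<in>{..j}. (- 1) ^ i * Q (\<rho> t) (x i) > 0)) (at_right 0)"
      using eventually_at_right_less[of "0::real"] by (intro eventually_conj)
    from eventually_happens'[OF _ this] obtain t where t: "t > 0" "\<rho> t \<in> V" "dist (\<rho> t) w0 < \<epsilon>"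
      "\<And>i. i \<le> j \<Longrightarrow> (- 1) ^ i * Q (\<rho> t) (x i) > 0" by (auto simp: dist_commute)
    have coeff: "\<rho> t $ e (Suc i) = (if i = k then t * (- 1) ^ Suc j else 0)" if "i \<le> k" for i
    proof -
      have "e (Suc i) = e (Suc k) \<longleftrightarrow> i = k" using inj_onD[OF e(1), of "Suc i" "Suc k"] that k(1) e(2) by auto
      then show ?thesis using w(3)[of i] that k(3) by (auto simp: \<rho>_def axis_def)
    qed
    have "eventually (\<lambda>z. (- 1) ^ Suc j * Q (\<rho> t) z > 0) (at_right 0)"
      unfolding Q_def
    proof (rule gderiv_0_sign_near_0[OF d scales[OF \<sigma>T[OF t(2)]] hd[OF \<sigma>T[OF t(2)]] k(2)])
      show "\<alpha> i (\<sigma> (\<rho> t)) = 0" if "i < k" for i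
        using \<alpha>\<sigma>[OF t(2), of i] coeff[of i] that k(1) by simp
      show "(- 1) ^ Suc j * \<alpha> k (\<sigma> (\<rho> t)) > 0"
        using \<alpha>\<sigma>[OF t(2), of k] coeff[of k] k(1) t(1)
        by (simp add: power_mult_distrib[symmetric] mult.assoc mult.left_commute flip: power_mult_distrib)
    qed
    moreover have "eventually (\<lambda>z. z \<in> {0<..<x j}) (at_right 0)"
      using x(2)[of j] by (intro eventually_at_right_0I[of "x j"]) auto
    ultimately have "eventually (\<lambda>z. (- 1) ^ Suc j * Q (\<rho> t) z > 0 \<and> z \<in> {0<..<x j}) (at_right 0)"
      by (rule eventually_conj)
    from eventually_happens'[OF _ this] obtain z where z: "(- 1) ^ Suc j * Q (\<rho> t) z > 0" "0 < z" "z < x j"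
      by auto
    define x' where "x' = x(Suc j := z)"
    have "x' (Suc i) < x' i" if "i < Suc j" for i
      using x(1)[of i] z that by (auto simp: x'_def less_Suc_eq)
    moreover have "x' i \<in> {0<..<\<delta>} \<and> (- 1) ^ i * Q (\<rho> t) (x' i) > 0" if "i \<le> Suc j" for i
    proof (cases "i = Suc j")
      case True
      then show ?thesis using z x(2)[of j] by (auto simp: x'_def)
    next
      case False
      then show ?thesis using that x(2)[of i] t(4)[of i] by (auto simp: x'_def)
    qed
    moreover have "\<rho> t $ e (Suc i) = 0" if "i < p - Suc j" for i
      using coeff[of i] that by (simp add: k_def)
    ultimately show ?case using t(2,3) by (intro exI[of _ "\<rho> t"] exI[of _ x']) auto
  qed
  have "\<exists>w y. w \<in> V \<and> dist w w0 < inverse (real (Suc n)) \<and> inj_on y {1..p} \<and>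
      (\<forall>j\<in>{1..p}. y j \<in> {0<..<min d (inverse (real (Suc n)))} \<and> f (\<sigma> w) (y j) = 0)" for n
  proof -
    define b where "b = min d (inverse (real (Suc n)))"
    have b: "0 < b" "b \<le> d" using d by (auto simp: b_def)
    obtain w x where w: "w \<in> V" "dist w w0 < inverse (real (Suc n))"
      and x: "\<And>i. i < p \<Longrightarrow> x (Suc i) < x i"
        "\<And>i. i \<le> p \<Longrightarrow> x i \<in> {0<..<b}" "\<And>i. i \<le> p \<Longrightarrow> (- 1) ^ i * Q w (x i) > 0"
      using step[of p "inverse (real (Suc n))" b] b by auto
    note wT = \<sigma>T[OF w(1)]
    have "gderivs_defined d l (u (\<sigma> w)) (f (\<sigma> w))"
      by (rule development_gderivs(2)[OF d scales[OF wT] hd[OF wT]])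
    then have "(Q w has_real_derivative deriv (Q w) x) (at x)" if "x \<in> {0<..<b}" for x
      using gderivs_defined_has_deriv[of d l "u (\<sigma> w)" "f (\<sigma> w)" 0 x] l that b by (simp add: Q_def[abs_def])
    then have "continuous_on {0<..<b} (Q w)"
      by (intro continuous_at_imp_continuous_on ballI) (blast intro: DERIV_isCont)
    from alternating_imp_zeros[OF this, of p x] x obtain y where y: "inj_on y {1..p}"
      "\<forall>j\<in>{1..p}. y j \<in> {0<..<b} \<and> Q w (y j) = 0" by blast
    have "f (\<sigma> w) (y j) = 0" if "j \<in> {1..p}" for j
    proof -
      have "y j \<in> {0<..<b} \<and> Q w (y j) = 0" using y(2) that by blast
      then have "y j \<in> {0<..<d}" "Q w (y j) = 0" using b by auto
      then show ?thesis using scale_u0_nonzero[OF d scales[OF wT], of "y j"] by (simp add: Q_def)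
    qed
    then show ?thesis using w y unfolding b_def by blast
  qed
  then obtain w y where wy: "\<And>n. w n \<in> V \<and> dist (w n) w0 < inverse (real (Suc n)) \<and> inj_on (y n) {1..p} \<and>
      (\<forall>j\<in>{1..p}. y n j \<in> {0<..<min d (inverse (real (Suc n)))} \<and> f (\<sigma> (w n)) (y n j) = 0)"
    by metis
  have "w \<longlonglongrightarrow> w0"
    unfolding tendsto_dist_iff[of w]
    by (rule tendsto_sandwich[OF _ _ tendsto_const LIMSEQ_inverse_real_of_nat])
      (use wy in \<open>auto intro!: always_eventually less_imp_le\<close>)
  then have "limitin (top_of_set V) w w0 sequentially"
    using wy V(2) by (auto simp: limitin_subtopology)
  then have lim: "limitin T (\<lambda>n. \<sigma> (w n)) lam0 sequentially"
    using continuous_map_limit[OF \<sigma>(1)] \<sigma>(2) by (fastforce simp: o_def)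
  have y0: "(\<lambda>n. y n j) \<longlonglongrightarrow> 0" if "j \<in> {1..p}" for j
    by (rule tendsto_sandwich[OF _ _ tendsto_const LIMSEQ_inverse_real_of_nat])
      (use wy that in \<open>fastforce intro!: always_eventually less_imp_le\<close>)+
  show ?thesis
    unfolding zero_mult_ge_def
  proof (intro exI[of _ "\<lambda>n. \<sigma> (w n)"] exI[of _ y] conjI allI ballI)
    show "\<sigma> (w n) \<in> topspace T" for n using wy \<sigma>T by blast
    show "inj_on (y n) {1..p}" for n using wy by blast
    fix n j assume "j \<in> {1..p}"
    then have "y n j \<in> {0<..<min d (inverse (real (Suc n)))} \<and> f (\<sigma> (w n)) (y n j) = 0"
      using wy by blast
    then show "y n j \<in> {0..<d}" "y n j \<noteq> 0" "f (\<sigma> (w n)) (y n j) = 0" by auto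
  qed (use lim y0 in auto)
qed

section \<open>The equivalences\<close>

theorem theorem3:
  fixes T :: "'l topology" and lam0 :: 'l
    and f \<psi> :: "'l \<Rightarrow> real \<Rightarrow> real" and u :: "'l \<Rightarrow> nat \<Rightarrow> real \<Rightarrow> real"
    and \<alpha> :: "nat \<Rightarrow> 'l \<Rightarrow> real"
    and c :: "'l \<Rightarrow> real ^ 'n" and e :: "nat \<Rightarrow> 'n"
    and d m M x0 :: real and r :: enat and k l :: nat
  assumes d: "d > 0"
    and r: "enat l \<le> r"
    and scales: "\<And>lam. lam \<in> topspace T \<Longrightarrow> chebyshev_scale d r l (u lam)"
    and dev: "uniform_development T d l u f \<alpha> \<psi>"
    and lam0: "lam0 \<in> topspace T"
    and u_pos: "\<And>i x. i \<in> {1..l} \<Longrightarrow> x \<in> {0<..<d} \<Longrightarrow> u lam0 i x > 0"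
    and u_incr: "\<And>i. i \<in> {1..l} \<Longrightarrow> strict_mono_on {0<..<d} (u lam0 i)"
    and f_cont: "continuous_on {0..<d} (f lam0)"
    and f_Cr: "Cr_on r {0<..<d} (f lam0)"
    and f_pos: "\<And>x. x \<in> {0<..<d} \<Longrightarrow> f lam0 x > 0"
    and f_0: "f lam0 0 = 0"
    and f'_0: "(f lam0 has_real_derivative 0) (at_right 0)"
    and m: "m > 1" and M: "M > 0"
    and log_deriv: "\<And>x. x \<in> {0<..<d} \<Longrightarrow>
           m \<le> x * deriv (\<lambda>t. ln (f lam0 t)) x \<and> x * deriv (\<lambda>t. ln (f lam0 t)) x \<le> M"
    and x0: "x0 \<in> {0<..<d}" "in_basin d (\<lambda>x. x - f lam0 x) x0"
    and k: "1 \<le> k" "k \<le> l"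
  shows
    "let g = (\<lambda>lam x. x - f lam x);
         D = (\<lambda>i. gderiv0 (u lam0) i (f lam0) 0);
         claim_i = ((\<forall>i<k. D i = 0) \<and> D k > 0);
         claim_ii = comparable_at_0 (nbhd_length (orbit_of (g lam0) x0)) (inv_into {0<..<d} (u lam0 k));
         claim_iii = critical_order_is d l (u lam0) (g lam0) x0 k;
         claim_iv = (fix_mult T d g lam0 = enat k);
         nonflat = (k = l \<longrightarrow> (\<exists>i\<le>l. D i \<noteq> 0))
     in
       (claim_i \<longleftrightarrow> comparable_at_0 (f lam0) (u lam0 k)) \<and>
       (claim_i \<longleftrightarrow> claim_ii) \<and>
       (claim_i \<longrightarrow> claim_iii) \<and>
       (nonflat \<longrightarrow> (claim_iii \<longrightarrow> claim_i)) \<and>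
       (regular_params T c e \<alpha> lam0 k \<longrightarrow>
          (claim_i \<longrightarrow> claim_iv) \<and>
          ((\<exists>i\<le>k. D i \<noteq> 0) \<or> regular_params T c e \<alpha> lam0 (Suc k) \<longrightarrow> (claim_iv \<longrightarrow> claim_i))) \<and>
       (claim_i \<or> claim_ii \<or> (claim_iii \<and> nonflat) \<longrightarrow> fix_mult T d g lam0 \<le> enat k)"
proof -
  define F where "F = f lam0"
  define v where "v = u lam0"
  define a where "a i = \<alpha> i lam0" for i
  define S where "S = orbit_of (\<lambda>x. x - F x) x0"
  have l: "0 < l" using k by simp
  have cheb: "chebyshev_scale d r l v" using scales[OF lam0] by (simp add: v_def)
  have hd: "has_development d l v F a (\<psi> lam0)"
    using dev lam0 by (simp add: uniform_development_def F_def v_def a_def[abs_def])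
  have D: "gderiv0 v i F 0 = a i" if "i \<le> l" for i
    using gderiv0_at_0_development[OF d cheb hd that] .
  have Fpos: "F x > 0" if "x \<in> {0<..<d}" for x using f_pos that by (simp add: F_def)
  have vpos: "v i x > 0" if "i \<le> l" "x \<in> {0<..<d}" for i x
  proof (cases "i = 0")
    case True
    have "v 1 x / v 0 x > 0" using gderiv_scale_pos[OF d cheb, of 0 1 x] l that by simp
    moreover have "v 1 x > 0" using u_pos[of 1 x] l that by (simp add: v_def)
    ultimately show ?thesis using True by (simp add: zero_less_divide_iff)
  next
    case False
    then show ?thesis using u_pos[of i x] that by (simp add: v_def)
  qed
  have ev_d: "eventually (\<lambda>x. x \<in> {0<..<d}) (at_right 0)"
    using d by (intro eventually_at_right_0I) auto
  have vcont: "continuous_on {0<..<d} (v i)" if "i \<le> l" for i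
  proof -
    have "continuous_on {0..<d} (v i)" using cheb that by (simp add: chebyshev_scale_def)
    then show ?thesis by (rule continuous_on_subset) auto
  qed
  have vmono: "strict_mono_on {0<..<d} (v i)" if "1 \<le> i" "i \<le> l" for i
    using u_incr[of i] that by (simp add: v_def)
  have vlim: "(v i \<longlongrightarrow> 0) (at_right 0)" if "1 \<le> i" "i \<le> l" for i
    using scale_tendsto_0[OF d cheb, of i] that by simp

  \<comment> \<open>If \<open>a p\<close> is the first nonzero coefficient, then \<open>F\<close> behaves like \<open>a p * v p\<close>. All claims are
    decided by the position of \<open>p\<close> relative to \<open>k\<close>.\<close>
  have quot: "((\<lambda>x. F x / v i x) \<longlongrightarrow> a i) (at_right 0)" if "i \<le> l" "\<And>j. j < i \<Longrightarrow> a j = 0" for i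
    by (rule development_quotient_tendsto[OF d cheb hd that])
  have a_pos: "a i > 0" if "i \<le> l" "\<And>j. j < i \<Longrightarrow> a j = 0" "a i \<noteq> 0" for i
  proof -
    have "eventually (\<lambda>x. 0 \<le> F x / v i x) (at_right 0)"
      using ev_d by eventually_elim (use Fpos vpos that(1) in \<open>auto intro!: divide_nonneg_nonneg less_imp_le\<close>)
    then have "0 \<le> a i" using quot[OF that(1,2)] by (intro tendsto_lowerbound) auto
    then show ?thesis using that(3) by simp
  qed
  have negligible: "((\<lambda>x. v i x / F x) \<longlongrightarrow> 0) (at_right 0)"
    if "p < i" "i \<le> l" "\<And>j. j < p \<Longrightarrow> a j = 0" "a p \<noteq> 0" for p i
  proof -
    have "((\<lambda>x. (v i x / v p x) / (F x / v p x)) \<longlongrightarrow> 0 / a p) (at_right 0)"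
      using that by (intro tendsto_divide scale_quotient_tendsto_0[OF d cheb] quot) auto
    moreover have "eventually (\<lambda>x. (v i x / v p x) / (F x / v p x) = v i x / F x) (at_right 0)"
      using ev_d
    proof eventually_elim
      case (elim x)
      have "v p x > 0" using vpos[of p x] that elim by simp
      then show ?case by simp
    qed
    ultimately have "((\<lambda>x. v i x / F x) \<longlongrightarrow> 0 / a p) (at_right 0)" by (rule Lim_transform_eventually)
    then show ?thesis by simp
  qed
  have dominated: "eventually (\<lambda>x. F x \<le> C * v i x) (at_right 0)"
    if "i \<le> l" "\<And>j. j < i \<Longrightarrow> a j = 0" "a i < C" for i C
  proof -
    have "eventually (\<lambda>x. F x / v i x < C) (at_right 0)" using quot[OF that(1,2)] that(3) by (rule order_tendstoD)
    then show ?thesis using ev_d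
    proof eventually_elim
      case (elim x)
      then show ?case using vpos[of i x] that(1) by (simp add: field_simps)
    qed
  qed
  have first: "(\<exists>p\<le>n. a p \<noteq> 0 \<and> (\<forall>j<p. a j = 0)) \<or> (\<forall>j\<le>n. a j = 0)" for n
  proof (cases "\<forall>j\<le>n. a j = 0")
    case False
    then obtain j where j: "j \<le> n" "a j \<noteq> 0" by auto
    define p where "p = (LEAST j. a j \<noteq> 0)"
    have "a p \<noteq> 0" unfolding p_def by (rule LeastI[of _ j]) (rule j)
    moreover have "p \<le> j" unfolding p_def by (rule Least_le) (rule j)
    moreover have "a i = 0" if "i < p" for i
      using not_less_Least[of i "\<lambda>j. a j \<noteq> 0"] that by (simp add: p_def)
    ultimately show ?thesis using j(1) by (intro disjI1 exI[of _ p]) auto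
  qed simp

  define claim_i where "claim_i \<longleftrightarrow> (\<forall>i<k. a i = 0) \<and> a k > 0"
  have comparable: "claim_i \<longleftrightarrow> comparable_at_0 F (v k)"
  proof
    assume claim_i
    then have lim: "((\<lambda>x. F x / v k x) \<longlongrightarrow> a k) (at_right 0)" and pos: "a k > 0"
      using quot[of k] k by (auto simp: claim_i_def)
    have "eventually (\<lambda>x. a k / 2 < F x / v k x) (at_right 0)" "eventually (\<lambda>x. F x / v k x < 2 * a k) (at_right 0)"
      by (rule order_tendstoD[OF lim]; use pos in simp)+
    then have "eventually (\<lambda>x. a k / 2 \<le> F x / v k x \<and> F x / v k x \<le> 2 * a k) (at_right 0)"
      by eventually_elim auto
    moreover have "a k / 2 > 0" "2 * a k > 0" using pos by auto
    ultimately show "comparable_at_0 F (v k)" unfolding comparable_at_0_iff_eventually by blast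
  next
    assume "comparable_at_0 F (v k)"
    then obtain A B where AB: "A > 0" "B > 0"
      "eventually (\<lambda>x. A \<le> F x / v k x \<and> F x / v k x \<le> B) (at_right 0)"
      by (auto simp: comparable_at_0_iff_eventually)
    from first[of k] show claim_i
    proof
      assume "\<exists>p\<le>k. a p \<noteq> 0 \<and> (\<forall>j<p. a j = 0)"
      then obtain p where p: "p \<le> k" "a p \<noteq> 0" "\<And>j. j < p \<Longrightarrow> a j = 0" by blast
      have "\<not> p < k"
      proof
        assume "p < k"
        have "eventually (\<lambda>x. v k x / F x < 1 / B) (at_right 0)"
          by (rule order_tendstoD(2)[OF negligible[OF \<open>p < k\<close> k(2) p(3,2)]]) (use AB in auto)
        then have "eventually (\<lambda>x. False) (at_right (0::real))"
          using AB(3) ev_d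
        proof eventually_elim
          case (elim x)
          then show ?case using AB Fpos[of x] vpos[OF k(2), of x] by (simp add: field_simps)
        qed
        then show False by simp
      qed
      then have "p = k" using p by simp
      then show claim_i using p a_pos[of k] k by (auto simp: claim_i_def)
    next
      assume zero: "\<forall>j\<le>k. a j = 0"
      have "eventually (\<lambda>x. F x / v k x < A) (at_right 0)"
        using order_tendstoD(2)[OF quot[OF k(2)], of A] zero AB by auto
      then have "eventually (\<lambda>x. False) (at_right (0::real))"
        using AB(3) by eventually_elim auto
      then show claim_i by simp
    qed
  qed

  \<comment> \<open>As the neighbourhood length at \<open>F x\<close> is comparable to \<open>x\<close>, it detects how \<open>F\<close> compares with
    each \<open>v i\<close>, and so the same \<open>p\<close>.\<close>
  have "enat (Suc 0) \<le> r" using r l by (metis Suc_leI enat_ord_simps(1) order_trans)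
  then have Fdiff: "F differentiable (at x)" if "x \<in> {0<..<d}" for x
    using f_Cr that unfolding Cr_on_def F_def by (metis funpow_0)
  interpret log_derivative_bounds d m M F
    using d m Fdiff Fpos log_deriv by unfold_locales (auto simp: F_def)
  have half: "eventually (\<lambda>x. F x \<le> x / 2) (at_right 0)"
  proof -
    have "((\<lambda>x. F x / x) \<longlongrightarrow> 0) (at_right 0)"
      using f'_0 f_0 by (simp add: has_field_derivative_iff F_def)
    then have "eventually (\<lambda>x. F x / x < 1 / 2) (at_right 0)" by (rule order_tendstoD) simp
    then show ?thesis using ev_d by eventually_elim (auto simp: field_simps)
  qed
  have basin: "in_basin d (\<lambda>x. x - F x) x0" using x0 by (simp add: F_def)
  obtain A0 B0 where AB0: "A0 > 0" "B0 > 0"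
    "eventually (\<lambda>x. A0 * x \<le> nbhd_length S (F x) \<and> nbhd_length S (F x) \<le> B0 * x) (at_right 0)"
    using orbit_nbhd_length_comparable[OF basin half] unfolding S_def by blast
  have "S \<subseteq> {0..d}"
    using basin unfolding S_def orbit_of_def in_basin_def by (auto simp: less_eq_real_def)
  then have "bounded S" by (rule bounded_subset[OF bounded_closed_interval])
  then interpret sampled_content d m M F A0 B0 "nbhd_length S"
    using AB0 by unfold_locales (auto intro: nbhd_length_mono nbhd_length_nonneg)

  have claim_ii: "claim_i \<longleftrightarrow> comparable_at_0 (nbhd_length S) (inv_into {0<..<d} (v k))"
    using comparable_inv_into_iff[OF d vcont[OF k(2)] vmono[OF k] vpos[OF k(2)] vlim[OF k]]
      comparable_iff_content_comparable[of "v k"] vpos[OF k(2)] comparable by blast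

  have lower_pos: "lower_content d S (v i) > 0" if i: "1 \<le> i" "i \<le> l" "\<And>j. j < i \<Longrightarrow> a j = 0" for i
  proof -
    obtain A where "A > 0" "eventually (\<lambda>x. A \<le> nbhd_length S (v i x) / x) (at_right 0)"
      using content_lower_bound[OF _ dominated[OF i(2,3), of "\<bar>a i\<bar> + 1"]] by force
    then show ?thesis
      using lower_content_posI[OF d vcont[OF i(2)] vmono[OF i(1,2)] _ vlim[OF i(1,2)]] vpos[OF i(2)] by blast
  qed
  have upper_nonpos: "upper_content d S (v i) \<le> 0"
    if "p < i" "i \<le> l" "\<And>j. j < p \<Longrightarrow> a j = 0" "a p \<noteq> 0" for p i
  proof -
    have i: "1 \<le> i" using that(1) by simp
    show ?thesis
      using upper_content_nonposI[OF d vcont[OF that(2)] vmono[OF i that(2)] _ vlim[OF i that(2)]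
            content_negligible[OF negligible[OF that]]] vpos[OF that(2)] by blast
  qed
  have lower_upper: "upper_content d S (v i) > 0" if "lower_content d S (v i) > 0" for i
    using that lower_content_le_upper_content[of d S "v i"] by (rule less_le_trans)
  have order: "critical_order_is d l v (\<lambda>x. x - F x) x0 p"
    if p: "1 \<le> p" "p \<le> l" "\<And>j. j < p \<Longrightarrow> a j = 0" "a p \<noteq> 0" for p
  proof -
    have "i \<le> p" if "i \<le> l" "upper_content d S (v i) > 0" for i
      using upper_nonpos[OF _ that(1) p(3,4)] that(2) by (meson leD leI)
    then show ?thesis
      using lower_pos[OF p(1-3)] lower_upper p
      unfolding critical_order_is_def is_greatest_def S_def[symmetric] by auto
  qed
  have order_unique: "i = j"
    if "critical_order_is d l v (\<lambda>x. x - F x) x0 i" "critical_order_is d l v (\<lambda>x. x - F x) x0 j" for i j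
    using that unfolding critical_order_is_def is_greatest_def by (meson le_antisym)
  define claim_iii where "claim_iii \<longleftrightarrow> critical_order_is d l v (\<lambda>x. x - F x) x0 k"
  define nonflat where "nonflat \<longleftrightarrow> (k = l \<longrightarrow> (\<exists>i\<le>l. a i \<noteq> 0))"
  have i_imp_iii: "claim_i \<Longrightarrow> claim_iii"
    using order[of k] k by (auto simp: claim_i_def claim_iii_def)
  have iii_imp_i: claim_i if claim_iii nonflat
  proof -
    from first[of l] show ?thesis
    proof
      assume "\<exists>p\<le>l. a p \<noteq> 0 \<and> (\<forall>j<p. a j = 0)"
      then obtain p where p: "p \<le> l" "a p \<noteq> 0" "\<And>j. j < p \<Longrightarrow> a j = 0" by blast
      have "p \<noteq> 0"
      proof
        assume "p = 0"
        then have "upper_content d S (v k) \<le> 0" using upper_nonpos[of 0 k] p k by auto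
        then show False using \<open>claim_iii\<close>
          by (auto simp: claim_iii_def critical_order_is_def is_greatest_def S_def[symmetric])
      qed
      then have "p = k" using order_unique[OF order[of p]] p \<open>claim_iii\<close> by (simp add: claim_iii_def)
      then show ?thesis using p a_pos[of k] k by (auto simp: claim_i_def)
    next
      \<comment> \<open>Then every content is positive and the critical order is \<open>l\<close>; so \<open>k = l\<close>, the flat case that is excluded.\<close>
      assume zero: "\<forall>j\<le>l. a j = 0"
      then have "lower_content d S (v l) > 0" using lower_pos[of l] l by auto
      then have "l \<le> k"
        using \<open>claim_iii\<close> l by (auto simp: claim_iii_def critical_order_is_def is_greatest_def S_def[symmetric])
      then show ?thesis using \<open>nonflat\<close> zero k by (auto simp: nonflat_def)
    qed
  qed

  \<comment> \<open>A coefficient \<open>a p \<noteq> 0\<close> bounds the multiplicity by \<open>p\<close>, and regular parameters with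
    \<open>a 0 = \<dots> = a (p - 1) = 0\<close> make it at least \<open>p\<close>.\<close>
  define \<mu> where "\<mu> = fix_mult T d (\<lambda>lam x. x - f lam x) lam0"
  have \<mu>: "\<mu> = Sup {enat p | p. zero_mult_ge T d f lam0 p}"
    by (simp add: \<mu>_def fix_mult_def zero_mult_def)
  have mult_le: "\<mu> \<le> enat p" if "p \<le> l" "a p \<noteq> 0" for p
    unfolding \<mu>
  proof (rule Sup_least)
    fix q assume "q \<in> {enat p | p. zero_mult_ge T d f lam0 p}"
    then obtain n where "q = enat n" "zero_mult_ge T d f lam0 n" by blast
    then show "q \<le> enat p"
      using zero_mult_bound[OF d scales dev that(1)] that(2) by (simp add: a_def)
  qed
  have mult_ge: "enat p \<le> \<mu>"
    if "0 < p" "p \<le> Suc l" "regular_params T c e \<alpha> lam0 p" "\<And>i. i < p \<Longrightarrow> a i = 0" for p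
  proof -
    have "eventually (\<lambda>x. gderiv v 0 F x > 0) (at_right 0)"
      using ev_d by eventually_elim (use vpos[of 0] Fpos in auto)
    then have "zero_mult_ge T d f lam0 p"
      using that by (intro zero_mult_ge_if_regular[OF d scales dev lam0 l])
        (auto simp: a_def v_def F_def)
    then show ?thesis unfolding \<mu> by (intro Sup_upper) auto
  qed
  have iv: "\<mu> = enat k" if claim_i "regular_params T c e \<alpha> lam0 k"
    using that mult_le[of k] mult_ge[of k] k by (auto simp: claim_i_def intro: antisym)
  have iv_imp_i: claim_i
    if "\<mu> = enat k" "(\<exists>i\<le>k. a i \<noteq> 0) \<or> regular_params T c e \<alpha> lam0 (Suc k)"
  proof -
    from first[of k] show ?thesis
    proof
      assume "\<exists>p\<le>k. a p \<noteq> 0 \<and> (\<forall>j<p. a j = 0)"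
      then obtain p where p: "p \<le> k" "a p \<noteq> 0" "\<And>j. j < p \<Longrightarrow> a j = 0" by blast
      then have "p = k" using mult_le[of p] that(1) k by simp
      then show ?thesis using p a_pos[of k] k by (auto simp: claim_i_def)
    next
      assume zero: "\<forall>j\<le>k. a j = 0"
      then have "enat (Suc k) \<le> \<mu>" using mult_ge[of "Suc k"] that(2) k by auto
      then show ?thesis using that(1) by simp
    qed
  qed
  have i_imp_mult_le: "claim_i \<Longrightarrow> \<mu> \<le> enat k" using mult_le[of k] k by (auto simp: claim_i_def)

  have Dk: "(\<forall>i<k. gderiv0 v i F 0 = 0) \<and> gderiv0 v k F 0 > 0 \<longleftrightarrow> claim_i"
    using D k by (simp add: claim_i_def)
  have Dk': "(\<exists>i\<le>k. gderiv0 v i F 0 \<noteq> 0) \<longleftrightarrow> (\<exists>i\<le>k. a i \<noteq> 0)" using D k by auto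
  have Dl: "(k = l \<longrightarrow> (\<exists>i\<le>l. gderiv0 v i F 0 \<noteq> 0)) \<longleftrightarrow> nonflat" using D by (auto simp: nonflat_def)
  show ?thesis
    unfolding Let_def F_def[symmetric] v_def[symmetric] Dk Dk' Dl S_def[symmetric]
      claim_iii_def[symmetric] \<mu>_def[symmetric]
    using comparable claim_ii i_imp_iii iii_imp_i iv iv_imp_i i_imp_mult_le by blast
qed

end
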